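(* Let $\Omega \subset \mathbb{R}^d$ be a bounded domain of positive Lebesgue measure, let $K \subset \mathbb{R}^d$ be a convex body symmetric with respect to the origin, let $\Lambda \subset \mathbb{R}^d$, and let $E_\Lambda = \{e^{2\pi i x\cdot\lambda}\}_{\lambda\in\Lambda}$. Throughout, $R>0$. (1) If $E_\Lambda$ is an orthogonal basis for $L^2(\Omega)$, then $$\#\{\lambda\in\Lambda : \|\lambda\|_K \le R\} = |K|\,R^d\,|\Omega| + E(R), \qquad \text{with } E(R)=o(R^d).$$ (2) Moreover, if in the situation of (1) the boundary $\partial\Omega$ of $\Omega$ has upper Minkowski dimension $\alpha<d$, then $$|E(R)| \le C_K\,|\partial\Omega|_\alpha\,R^\alpha ,$$ where, for the given $K$, $C_K$ is a constant depending on the domain $\Omega$ only. (3) If $E_\Lambda$ is merely a frame for $L^2(\Omega)$ with frame constants $A$ and $B$ (in the normalization given in the context), then $$A|\Omega| \le \frac{\#\{\lambda\in\Lambda : \|\lambda\|_K\le R\}}{|K|R^d} \le B|\Omega| .$$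
   Context: $|\cdot|$ denotes Lebesgue measure of subsets of $\mathbb{R}^d$, and $\#$ denotes cardinality. For a convex body $K$ (a compact convex set with nonempty interior) symmetric about the origin, $\|x\|_K = \inf\{t>0 : x\in tK\}$ is the norm induced by $K$, i.e. the norm whose unit ball is $K$. The notation $o(R^d)$ refers to $R\to\infty$. $L^2(\Omega)$ is taken with respect to Lebesgue measure. $E_\Lambda$ is an orthogonal basis for $L^2(\Omega)$ if its elements, restricted to $\Omega$, are pairwise orthogonal and their linear span is dense in $L^2(\Omega)$. For $g\in L^2(\Omega)$ put $\hat g(\xi)=\int_\Omega g(x)e^{-2\pi i x\cdot\xi}\,dx$. $E_\Lambda$ is a frame for $L^2(\Omega)$ with constants $A,B>0$ if for all $g\in L^2(\Omega)$ $$A\,|\Omega|\,\|g\|_{L^2(\Omega)}^2 \le \sum_{\lambda\in\Lambda} |\hat g(\lambda)|^2 \le B\,|\Omega|\,\|g\|_{L^2(\Omega)}^2 .$$ With this normalization an orthogonal basis $E_\Lambda$ is a frame with $A=B=1$. $|\partial\Omega|_\alpha$ denotes the $\alpha$-dimensional upper Minkowski content of $\partial\Omega$, which up to a normalizing constant depending only on $d$ and $\alpha$ is $\limsup_{h\to 0^+} h^{-(d-\alpha)}\,|\{x\in\mathbb{R}^d : \mathrm{dist}(x,\partial\Omega)<h\}|$. The upper Minkowski dimension of $\partial\Omega$ is the infimum of the $\alpha$ for which this quantity is finite.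
   Formalization: As written, (2) and (3) fail. (2) is proved for R ≥ 1 rather than all R > 0, assuming the α-dimensional Minkowski content of the boundary is positive (infinite allowed). (3) is proved asymptotically: A|Ω| ≤ liminf and limsup ≤ B|Ω| of the quotient as R → ∞. *)

theory Defs
  imports "HOL-Analysis.Analysis" "HOL-Library.Landau_Symbols"
begin

definition convex_body :: "'a::euclidean_space set \<Rightarrow> bool" where
  "convex_body K \<longleftrightarrow> compact K \<and> convex K \<and> interior K \<noteq> {}"

definition body_norm :: "'a::euclidean_space set \<Rightarrow> 'a \<Rightarrow> real" where
  "body_norm K x = Inf {t. t > 0 \<and> x \<in> (\<lambda>y. t *\<^sub>R y) ` K}"

definition echar :: "'a::euclidean_space \<Rightarrow> 'a \<Rightarrow> complex" where
  "echar l x = exp (2 * complex_of_real pi * \<i> * complex_of_real (x \<bullet> l))"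

(* Functions rather than classes modulo null sets; every notion below depends only on
   the values of g on \<Omega> up to a null set. *)
definition L2 :: "'a::euclidean_space set \<Rightarrow> ('a \<Rightarrow> complex) set" where
  "L2 \<Omega> = {g \<in> borel_measurable (lebesgue_on \<Omega>).
             integrable (lebesgue_on \<Omega>) (\<lambda>x. (cmod (g x))\<^sup>2)}"

definition L2_inner :: "'a::euclidean_space set \<Rightarrow> ('a \<Rightarrow> complex) \<Rightarrow> ('a \<Rightarrow> complex) \<Rightarrow> complex" where
  "L2_inner \<Omega> f g = integral\<^sup>L (lebesgue_on \<Omega>) (\<lambda>x. f x * cnj (g x))"

definition L2_norm :: "'a::euclidean_space set \<Rightarrow> ('a \<Rightarrow> complex) \<Rightarrow> real" where
  "L2_norm \<Omega> g = sqrt (integral\<^sup>L (lebesgue_on \<Omega>) (\<lambda>x. (cmod (g x))\<^sup>2))"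

definition exp_orthogonal_basis :: "'a::euclidean_space set \<Rightarrow> 'a set \<Rightarrow> bool" where
  "exp_orthogonal_basis \<Omega> \<Lambda> \<longleftrightarrow>
     (\<forall>l\<in>\<Lambda>. \<forall>m\<in>\<Lambda>. l \<noteq> m \<longrightarrow> L2_inner \<Omega> (echar l) (echar m) = 0) \<and>
     (\<forall>g\<in>L2 \<Omega>. \<forall>\<epsilon>>0. \<exists>F c. finite F \<and> F \<subseteq> \<Lambda> \<and>
        L2_norm \<Omega> (\<lambda>x. g x - (\<Sum>l\<in>F. c l * echar l x)) < \<epsilon>)"

definition fourier_on :: "'a::euclidean_space set \<Rightarrow> ('a \<Rightarrow> complex) \<Rightarrow> 'a \<Rightarrow> complex" where
  "fourier_on \<Omega> g \<xi> = integral\<^sup>L (lebesgue_on \<Omega>)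
     (\<lambda>x. g x * exp (- 2 * complex_of_real pi * \<i> * complex_of_real (x \<bullet> \<xi>)))"

(* The sum is taken in ennreal, so that it is meaningful (possibly infinite) for an
   arbitrary, a priori even uncountable, index set. *)
definition exp_frame :: "'a::euclidean_space set \<Rightarrow> 'a set \<Rightarrow> real \<Rightarrow> real \<Rightarrow> bool" where
  "exp_frame \<Omega> \<Lambda> A B \<longleftrightarrow> A > 0 \<and> B > 0 \<and>
     (\<forall>g\<in>L2 \<Omega>.
        ennreal (A * measure lebesgue \<Omega> * (L2_norm \<Omega> g)\<^sup>2)
          \<le> (\<Sum>\<^sub>\<infinity>l\<in>\<Lambda>. ennreal ((cmod (fourier_on \<Omega> g l))\<^sup>2)) \<and>
        (\<Sum>\<^sub>\<infinity>l\<in>\<Lambda>. ennreal ((cmod (fourier_on \<Omega> g l))\<^sup>2))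
          \<le> ennreal (B * measure lebesgue \<Omega> * (L2_norm \<Omega> g)\<^sup>2))"

(* Normalizing constant 1. For S = {} this is not meaningful, since infdist x {} = 0. *)
definition upper_minkowski_content :: "'a::euclidean_space set \<Rightarrow> real \<Rightarrow> ennreal" where
  "upper_minkowski_content S \<alpha> =
     Limsup (at_right 0) (\<lambda>h::real. ennreal (h powr (- (real DIM('a) - \<alpha>))) *
                                      emeasure lebesgue {x. infdist x S < h})"

(* For nonempty S the content is infinite at every negative exponent, so restricting to
   \<alpha> \<ge> 0 does not change the infimum. For bounded S the set contains DIM('a). *)
definition upper_minkowski_dim :: "'a::euclidean_space set \<Rightarrow> real" where
  "upper_minkowski_dim S = Inf {\<alpha>. 0 \<le> \<alpha> \<and> upper_minkowski_content S \<alpha> < \<infinity>}"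

definition freqs :: "'a::euclidean_space set \<Rightarrow> 'a set \<Rightarrow> real \<Rightarrow> 'a set" where
  "freqs K \<Lambda> R = {l \<in> \<Lambda>. body_norm K l \<le> R}"

(* Meaningful only if freqs K \<Lambda> R is finite, because card of an infinite set is 0. *)
definition weyl_error :: "'a::euclidean_space set \<Rightarrow> 'a set \<Rightarrow> 'a set \<Rightarrow> real \<Rightarrow> real" where
  "weyl_error \<Omega> K \<Lambda> R =
     real (card (freqs K \<Lambda> R)) - measure lebesgue K * R ^ DIM('a) * measure lebesgue \<Omega>"

end

theory Submission
  imports Defs "HOL-Probability.Sinc_Integral" "HOL-Real_Asymp.Real_Asymp"
begin

text \<open>
  All three assertions come from one estimate with error of order \<open>R ^ (d - 1)\<close>, where \<open>d\<close> is the
  dimension: for a frame of exponentials with constants \<open>A\<close> and \<open>B\<close>, if \<open>R \<ge> 1\<close>, the number \<open>N(R)\<close> of frequencies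
  in \<open>R K\<close> lies between \<open>A |\<Omega>| |K| R ^ d - C R ^ (d - 1)\<close> and \<open>B |\<Omega>| |K| R ^ d + C R ^ (d - 1)\<close>,
  with \<open>C\<close> depending only on \<open>\<Omega>\<close>, \<open>K\<close> and \<open>B\<close>
  (\<open>frame_counting_estimate\<close>).

  Choose a test function \<open>g\<close> supported in a small cube inside \<open>\<Omega>\<close>, and let \<open>\<psi>\<close> be the squared
  modulus of its Fourier transform. Modulating \<open>g\<close> by the character with frequency \<open>\<xi>\<close> translates
  \<open>\<psi>\<close>, so the frame inequality says that, for every \<open>\<xi>\<close>, the sum of \<open>\<psi> (\<lambda> - \<xi>)\<close> over the frequencies
  \<open>\<lambda>\<close> lies between \<open>A |\<Omega>|\<close> and \<open>B |\<Omega>|\<close> times the squared norm of \<open>g\<close>. Integrate this over \<open>\<xi>\<close> in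
  \<open>R K\<close>. By Plancherel the integral of \<open>\<psi>\<close> is the squared norm of \<open>g\<close>; hence, if each \<open>\<lambda>\<close> in \<open>R K\<close>
  contributed all of its mass and each other \<open>\<lambda>\<close> none, the result would be \<open>N(R)\<close> times this
  squared norm. The defect comes from pairs \<open>(\<lambda>, \<xi>)\<close> which the boundary of \<open>R K\<close> separates. For a fixed
  difference \<open>\<eta> = \<lambda> - \<xi>\<close>, the points in question lie in a shell of thickness \<open>O(1 + |\<eta>|)\<close>, and since the
  upper frame bound also limits the number of frequencies in a ball of fixed radius, there are
  \<open>O((1 + |\<eta>|) R ^ (d - 1))\<close> of them (\<open>card_leaving_dilate\<close>). The defect is therefore
  \<open>O(R ^ (d - 1))\<close> as soon as \<open>\<psi>\<close> has a finite first moment (\<open>kernel_sum_counting\<close>).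

  This moment condition dictates the choice of \<open>g\<close>. The indicator function of \<open>\<Omega>\<close>, however regular
  \<open>\<Omega>\<close> may be, has a power spectrum with infinite first moment, and using it would lose a logarithm
  when the boundary has dimension \<open>d - 1\<close>. A product of tent functions is explicit and continuous,
  with a power spectrum that is a product of fourth powers of the sinc function; its integral and its
  first moment are computed directly, which also replaces the general Plancherel theorem.

  An orthogonal basis is a frame with \<open>A = B = 1\<close> by Parseval's identity
  (\<open>exp_orthogonal_basis_imp_frame\<close>). This gives the asymptotics for bases, and dividing by
  \<open>|K| R ^ d\<close> gives the density bounds for frames. For the bound in terms of the Minkowski content
  it remains to see that the boundary of a bounded open set of positive measure has upper Minkowski
  dimension at least \<open>d - 1\<close> (\<open>upper_minkowski_dim_frontier_ge\<close>), so that \<open>R ^ (d - 1)\<close> is at most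
  \<open>R powr \<alpha>\<close> for \<open>R \<ge> 1\<close>; a positive finite content is then absorbed into the constant.
\<close>

section \<open>The fourth moment of the sinc function\<close>

lemma nn_integral_even:
  fixes f :: "real \<Rightarrow> ennreal"
  assumes [measurable]: "f \<in> borel_measurable borel" and even: "\<And>x. f (- x) = f x"
  shows "(\<integral>\<^sup>+x. f x \<partial>lborel) = 2 * (\<integral>\<^sup>+x. f x * indicator {0..} x \<partial>lborel)"
proof -
  have "(\<integral>\<^sup>+x. f x \<partial>lborel) = (\<integral>\<^sup>+x. f x * indicator {0..} x + f x * indicator {..0} x \<partial>lborel)"
    using AE_lborel_singleton[of "0::real"]
    by (intro nn_integral_cong_AE) (auto split: split_indicator)
  also have "\<dots> = (\<integral>\<^sup>+x. f x * indicator {0..} x \<partial>lborel) + (\<integral>\<^sup>+x. f x * indicator {..0} x \<partial>lborel)"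
    by (intro nn_integral_add) auto
  also have "(\<integral>\<^sup>+x. f x * indicator {..0} x \<partial>lborel) = (\<integral>\<^sup>+x. f x * indicator {0..} x \<partial>lborel)"
    by (subst nn_integral_real_affine[where c="-1" and t=0])
       (auto simp: even intro!: nn_integral_cong split: split_indicator)
  finally show ?thesis
    by (simp add: mult_2)
qed

text \<open>Integrating by parts three times turns \<open>sin x ^ 4 / x ^ 4\<close> into the third derivative of
  \<open>sin x ^ 4\<close> divided by \<open>6 x\<close>, and this third derivative is \<open>8 sin (4 x) - 4 sin (2 x)\<close>. Hence there
  is an explicit antiderivative in terms of the sine integral, whose limit at infinity is known.\<close>

lemma integral_sinc_power4_pos:
  shows "set_integrable lborel {0<..} (\<lambda>x::real. sin x ^ 4 / x ^ 4)"
    and "(LBINT x:{0<..}. sin x ^ 4 / x ^ 4) = pi / 3"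
proof -
  define F where "F = (\<lambda>x::real. - (sin x ^ 4 / (3 * x ^ 3) + 4 * sin x ^ 3 * cos x / (6 * x\<^sup>2)
      + (12 * (sin x)\<^sup>2 * (cos x)\<^sup>2 - 4 * sin x ^ 4) / (6 * x))
      + (4/3 * Si (4 * x) - 2/3 * Si (2 * x)))"
  have der: "DERIV F x :> sin x ^ 4 / x ^ 4" if "x > 0" for x
  proof -
    define s c where "s = sin x" and "c = cos x"
    have sc: "c\<^sup>2 = 1 - s\<^sup>2" unfolding s_def c_def by (simp add: cos_squared_eq)
    have s2: "sin (2 * x) = 2 * s * c" unfolding s_def c_def by (rule sin_double)
    have s4: "sin (4 * x) = 4 * s * c * (1 - 2 * s\<^sup>2)"
      using sin_double[of "2 * x"] cos_double_sin[of x] s2 by (simp add: s_def c_def)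
    have S4: "((\<lambda>x. Si (4 * x)) has_real_derivative sin (4 * x) / (4 * x) * 4) (at x)"
      using that by (intro DERIV_chain2[OF DERIV_Si, THEN DERIV_cong] derivative_eq_intros refl) auto
    have S2: "((\<lambda>x. Si (2 * x)) has_real_derivative sin (2 * x) / (2 * x) * 2) (at x)"
      using that by (intro DERIV_chain2[OF DERIV_Si, THEN DERIV_cong] derivative_eq_intros refl) auto
    show ?thesis
      unfolding F_def
      apply (rule DERIV_cong)
       apply (rule derivative_eq_intros refl S4 S2 | use that in force)+
      apply (use that in \<open>simp add: s_def[symmetric] c_def[symmetric] s2 s4\<close>)
      apply (simp add: divide_simps)
      apply (use sc in algebra)
      done
  qed
  have lim0: "((\<lambda>x::real. - (sin x ^ 4 / (3 * x ^ 3) + 4 * sin x ^ 3 * cos x / (6 * x\<^sup>2)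
      + (12 * (sin x)\<^sup>2 * (cos x)\<^sup>2 - 4 * sin x ^ 4) / (6 * x))) \<longlongrightarrow> 0) (at_right 0)"
    by real_asymp
  have Si0: "Si 0 = 0" unfolding Si_def by (simp add: zero_ereal_def[symmetric])
  have "isCont (\<lambda>x. 4/3 * Si (4 * x) - 2/3 * Si (2 * x)) 0"
    by (intro continuous_intros isCont_o2[OF _ isCont_Si]) auto
  hence "((\<lambda>x. 4/3 * Si (4 * x) - 2/3 * Si (2 * x)) \<longlongrightarrow> 0) (at_right 0)"
    unfolding isCont_def by (auto simp: Si0 intro: filterlim_mono at_le)
  from tendsto_add[OF lim0 this] have F0: "(F \<longlongrightarrow> 0) (at_right 0)" unfolding F_def by simp
  have lim1: "((\<lambda>x::real. - (sin x ^ 4 / (3 * x ^ 3) + 4 * sin x ^ 3 * cos x / (6 * x\<^sup>2)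
      + (12 * (sin x)\<^sup>2 * (cos x)\<^sup>2 - 4 * sin x ^ 4) / (6 * x))) \<longlongrightarrow> 0) at_top"
    by real_asymp
  have m: "filterlim (\<lambda>x. k * x) at_top at_top" if "k > 0" for k :: real
    using that by (simp add: filterlim_tendsto_pos_mult_at_top[OF tendsto_const _ filterlim_ident])
  have "((\<lambda>x. 4/3 * Si (4 * x) - 2/3 * Si (2 * x)) \<longlongrightarrow> 4/3 * (pi/2) - 2/3 * (pi/2)) at_top"
    by (intro tendsto_intros filterlim_compose[OF Si_at_top] m) auto
  from tendsto_add[OF lim1 this] have F1: "(F \<longlongrightarrow> pi/3) at_top" unfolding F_def by simp
  have e: "einterval 0 \<infinity> = {0::real<..}" by (auto simp: einterval_def zero_ereal_def)
  have "set_integrable lborel (einterval 0 \<infinity>) (\<lambda>x::real. sin x ^ 4 / x ^ 4)"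
       "(LBINT x=0..\<infinity>. sin x ^ 4 / x ^ 4) = pi/3 - 0"
    by (rule interval_integral_FTC_nonneg[where F = F];
        use F0 F1 der in \<open>auto simp: zero_ereal_def ereal_tendsto_simps intro!: continuous_intros\<close>)+
  then show "set_integrable lborel {0<..} (\<lambda>x::real. sin x ^ 4 / x ^ 4)"
    "(LBINT x:{0<..}. sin x ^ 4 / x ^ 4) = pi / 3"
    by (auto simp: e interval_lebesgue_integral_0_infty)
qed

lemma nn_integral_sinc_power4: "(\<integral>\<^sup>+x. ennreal (sinc x ^ 4) \<partial>lborel) = ennreal (2 * pi / 3)"
proof -
  have "(\<integral>\<^sup>+x. ennreal (sinc x ^ 4) * indicator {0..} x \<partial>lborel)
      = (\<integral>\<^sup>+x. ennreal (indicator {0<..} x *\<^sub>R (sin x ^ 4 / x ^ 4)) \<partial>lborel)"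
    using AE_lborel_singleton[of "0::real"]
    by (intro nn_integral_cong_AE) (auto split: split_indicator simp: power_divide)
  also have "\<dots> = ennreal (pi / 3)"
    using integral_sinc_power4_pos
    by (subst nn_integral_eq_integral) (auto simp: set_integrable_def set_lebesgue_integral_def)
  finally have *: "(\<integral>\<^sup>+x. ennreal (sinc x ^ 4) * indicator {0..} x \<partial>lborel) = ennreal (pi / 3)" .
  have sinc_m: "(\<lambda>x. ennreal (sinc x ^ 4)) \<in> borel_measurable borel"
    by (intro measurable_compose[OF _ measurable_ennreal] borel_measurable_continuous_onI continuous_intros)
  show ?thesis
    by (subst nn_integral_even, intro sinc_m, simp, unfold *)
       (auto simp: ennreal_mult[symmetric] simp flip: ennreal_numeral)
qed

section \<open>The tent function and its Fourier transform\<close>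

definition tent :: "real \<Rightarrow> real \<Rightarrow> real" where
  "tent s t = max 0 (1 - \<bar>t\<bar> / s)"

lemma continuous_on_tent [continuous_intros]:
  "continuous_on A f \<Longrightarrow> continuous_on A (\<lambda>x. tent s (f x))"
  unfolding tent_def divide_inverse by (intro continuous_intros)

lemma borel_measurable_tent [measurable]: "tent s \<in> borel_measurable borel"
  by (intro borel_measurable_continuous_onI continuous_intros)

lemma tent_eq_0: "s > 0 \<Longrightarrow> \<bar>t\<bar> \<ge> s \<Longrightarrow> tent s t = 0"
  by (auto simp: tent_def)

text \<open>The tent is affine on each half of its support, so integrals against it reduce to one
  antiderivative on either side of the origin.\<close>

lemma has_bochner_integral_tent_mult:
  fixes h :: "real \<Rightarrow> 'b::euclidean_space"
  assumes s: "s > 0" and h: "continuous_on UNIV h"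
    and F: "\<And>t. -s \<le> t \<Longrightarrow> t \<le> 0 \<Longrightarrow> (F has_vector_derivative (1 + t / s) *\<^sub>R h t) (at t within {-s..0})"
    and G: "\<And>t. 0 \<le> t \<Longrightarrow> t \<le> s \<Longrightarrow> (G has_vector_derivative (1 - t / s) *\<^sub>R h t) (at t within {0..s})"
  shows "has_bochner_integral lborel (\<lambda>t. tent s t *\<^sub>R h t) ((F 0 - F (-s)) + (G s - G 0))"
proof -
  have hc: "continuous_on A h" for A by (rule continuous_on_subset[OF h]) auto
  have "has_bochner_integral lborel (\<lambda>t. indicator {-s..0} t *\<^sub>R ((1 + t / s) *\<^sub>R h t)
       + indicator {0..s} t *\<^sub>R ((1 - t / s) *\<^sub>R h t)) ((F 0 - F (-s)) + (G s - G 0))"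
    using s by (intro has_bochner_integral_add has_bochner_integral_FTC_Icc F G)
       (auto intro!: continuous_intros hc)
  moreover have "AE t in lborel. indicator {-s..0} t *\<^sub>R ((1 + t / s) *\<^sub>R h t)
       + indicator {0..s} t *\<^sub>R ((1 - t / s) *\<^sub>R h t) = tent s t *\<^sub>R h t"
    using AE_lborel_singleton[of "0::real"] 
    by eventually_elim (use s in \<open>auto simp: tent_def max_def field_simps split: split_indicator\<close>)
  moreover have "h \<in> borel_measurable borel" using h by (rule borel_measurable_continuous_onI)
  ultimately show ?thesis
    by (subst has_bochner_integral_cong_AE[where g = "\<lambda>t. indicator {-s..0} t *\<^sub>R ((1 + t / s) *\<^sub>R h t)
       + indicator {0..s} t *\<^sub>R ((1 - t / s) *\<^sub>R h t)"]) (auto elim!: eventually_mono)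
qed

lemma has_bochner_integral_tent_squared:
  assumes s: "s > 0"
  shows "has_bochner_integral lborel (\<lambda>t. (tent s t)\<^sup>2) (2 * s / 3)"
proof -
  have "has_bochner_integral lborel (\<lambda>t. tent s t *\<^sub>R tent s t)
     ((s / 3 * (1 + 0 / s) ^ 3 - s / 3 * (1 + (-s) / s) ^ 3) + ((- s / 3 * (1 - s / s) ^ 3) - (- s / 3 * (1 - 0 / s) ^ 3)))"
    by (rule has_bochner_integral_tent_mult[OF s])
       (use s in \<open>auto intro!: continuous_intros derivative_eq_intros
           simp: has_real_derivative_iff_has_vector_derivative[symmetric] tent_def field_simps eval_nat_numeral\<close>)
  then show ?thesis using s by (simp add: power2_eq_square)
qed

lemma has_bochner_integral_tent_exp_0:
  assumes s: "s > 0"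
  shows "has_bochner_integral lborel (\<lambda>t. complex_of_real (tent s t)) (complex_of_real s)"
proof -
  have "has_bochner_integral lborel (\<lambda>t. tent s t *\<^sub>R (1::real))
     (((0 + 0\<^sup>2 / (2 * s)) - ((-s) + (-s)\<^sup>2 / (2 * s))) + ((s - s\<^sup>2 / (2 * s)) - (0 - 0\<^sup>2 / (2 * s))))"
    by (rule has_bochner_integral_tent_mult[OF s])
       (use s in \<open>auto intro!: continuous_intros derivative_eq_intros
           simp: has_real_derivative_iff_has_vector_derivative[symmetric] field_simps\<close>)
  then have "has_bochner_integral lborel (\<lambda>t. tent s t) s" using s by (simp add: power2_eq_square)
  then show ?thesis by (rule has_bochner_integral_of_real)
qed

text \<open>The two antiderivatives come from integrating an affine function times \<open>exp (a t)\<close> with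
  \<open>a = - 2 pi \<i> \<xi>\<close>. Their boundary terms combine to a second difference of the exponential, which
  is a squared sine. The frequency zero, where \<open>a\<close> cannot be divided by, is the area of the tent.\<close>

lemma has_bochner_integral_tent_exp:
  assumes s: "s > 0"
  shows "has_bochner_integral lborel
      (\<lambda>t. complex_of_real (tent s t) * exp (- 2 * complex_of_real pi * \<i> * complex_of_real (t * \<xi>)))
      (complex_of_real (s * (sinc (pi * s * \<xi>))\<^sup>2))"
proof (cases "\<xi> = 0")
  case True
  then show ?thesis using has_bochner_integral_tent_exp_0[OF s] by simp
next
  case False
  define w where "w = 2 * pi * \<xi>"
  define a where "a = - \<i> * complex_of_real w"
  have w: "w \<noteq> 0" using False by (simp add: w_def)
  hence a: "a \<noteq> 0" by (simp add: a_def)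
  define F where "F = (\<lambda>t::real. ((1 + complex_of_real t / s) / a - 1 / (s * a\<^sup>2)) * exp (a * t))"
  define G where "G = (\<lambda>t::real. ((1 - complex_of_real t / s) / a + 1 / (s * a\<^sup>2)) * exp (a * t))"
  have c: "complex_of_real s \<noteq> 0" using s by simp
  have "has_bochner_integral lborel (\<lambda>t. tent s t *\<^sub>R exp (a * complex_of_real t))
     ((F 0 - F (-s)) + (G s - G 0))"
  proof (rule has_bochner_integral_tent_mult[OF s])
    show "continuous_on UNIV (\<lambda>t::real. exp (a * complex_of_real t))" by (intro continuous_intros)
    have "((\<lambda>z. ((1 + z / s) / a - 1 / (s * a\<^sup>2)) * exp (a * z)) has_field_derivative
        (1 + z / s) * exp (a * z)) (at z)" for z
      using a c by (auto intro!: derivative_eq_intros simp: field_simps power2_eq_square)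
    from has_vector_derivative_real_field[OF this]
    show "(F has_vector_derivative (1 + t / s) *\<^sub>R exp (a * complex_of_real t)) (at t within {- s..0})" for t
      unfolding F_def by (simp add: scaleR_conv_of_real)
    have "((\<lambda>z. ((1 - z / s) / a + 1 / (s * a\<^sup>2)) * exp (a * z)) has_field_derivative
        (1 - z / s) * exp (a * z)) (at z)" for z
      using a c by (auto intro!: derivative_eq_intros simp: field_simps power2_eq_square)
    from has_vector_derivative_real_field[OF this]
    show "(G has_vector_derivative (1 - t / s) *\<^sub>R exp (a * complex_of_real t)) (at t within {0..s})" for t
      unfolding G_def by (simp add: scaleR_conv_of_real)
  qed
  also have "(F 0 - F (-s)) + (G s - G 0) = (exp (a * s) + exp (- (a * s)) - 2) / (s * a\<^sup>2)"
    unfolding F_def G_def using c a by (simp add: field_simps)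
  also have "\<dots> = complex_of_real ((2 - 2 * cos (w * s)) / (s * w\<^sup>2))"
  proof -
    have "exp (a * s) + exp (- (a * s)) = 2 * complex_of_real (cos (w * s))"
      unfolding a_def by (simp flip: cos_of_real add: cos_exp_eq mult.assoc)
    moreover have "a\<^sup>2 = - complex_of_real (w\<^sup>2)" by (simp add: a_def power_mult_distrib)
    ultimately show ?thesis using w by (simp add: minus_divide_left)
  qed
  also have "(2 - 2 * cos (w * s)) / (s * w\<^sup>2) = s * (sinc (pi * s * \<xi>))\<^sup>2"
  proof -
    have "cos (w * s) = 1 - 2 * (sin (pi * s * \<xi>))\<^sup>2"
      using cos_double_sin[of "pi * s * \<xi>"] by (simp add: w_def mult_ac)
    then show ?thesis
      using s False by (simp add: w_def power_divide power_mult_distrib) (simp add: field_simps power2_eq_square)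
  qed
  also have "(\<lambda>t. tent s t *\<^sub>R exp (a * complex_of_real t)) =
    (\<lambda>t. complex_of_real (tent s t) * exp (- 2 * complex_of_real pi * \<i> * complex_of_real (t * \<xi>)))"
    by (auto simp: a_def w_def scaleR_conv_of_real mult_ac)
  finally show ?thesis .
qed

text \<open>The power spectrum, that is, the squared modulus of the Fourier transform, of the tent.\<close>

definition tent_spectrum :: "real \<Rightarrow> real \<Rightarrow> real" where
  "tent_spectrum s t = (s * (sinc (pi * s * t))\<^sup>2)\<^sup>2"

lemma tent_spectrum_nonneg: "0 \<le> tent_spectrum s t" and tent_spectrum_0: "tent_spectrum s 0 = s\<^sup>2"
  by (auto simp: tent_spectrum_def)

lemma continuous_on_tent_spectrum [continuous_intros]:
  "continuous_on A f \<Longrightarrow> continuous_on A (\<lambda>x. tent_spectrum s (f x))"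
  unfolding tent_spectrum_def by (intro continuous_intros)

lemma borel_measurable_tent_spectrum [measurable]: "tent_spectrum s \<in> borel_measurable borel"
  by (intro borel_measurable_continuous_onI continuous_intros)

text \<open>Plancherel's identity for the tent: the value agrees with the squared norm in
  \<open>has_bochner_integral_tent_squared\<close>.\<close>

lemma nn_integral_tent_spectrum:
  assumes s: "s > 0"
  shows "(\<integral>\<^sup>+t. ennreal (tent_spectrum s t) \<partial>lborel) = ennreal (2 * s / 3)"
proof -
  have "ennreal (2 * pi / 3) = ennreal \<bar>pi * s\<bar> * (\<integral>\<^sup>+t. ennreal (sinc (0 + pi * s * t) ^ 4) \<partial>lborel)"
    unfolding nn_integral_sinc_power4[symmetric]
    using s by (intro nn_integral_real_affine measurable_compose[OF _ measurable_ennreal]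
       borel_measurable_continuous_onI continuous_intros) auto
  hence "ennreal (s / pi) * ennreal (2 * pi / 3) = 
    ennreal (s / pi) * (ennreal \<bar>pi * s\<bar> * (\<integral>\<^sup>+t. ennreal (sinc (0 + pi * s * t) ^ 4) \<partial>lborel))"
    by (rule arg_cong)
  also have "\<dots> = ennreal (s / pi * \<bar>pi * s\<bar>) * (\<integral>\<^sup>+t. ennreal (sinc (0 + pi * s * t) ^ 4) \<partial>lborel)"
    using s by (subst ennreal_mult) (auto simp: mult_ac)
  also have "s / pi * \<bar>pi * s\<bar> = s\<^sup>2" using s by (simp add: power2_eq_square)
  also have "ennreal (s\<^sup>2) * (\<integral>\<^sup>+t. ennreal (sinc (0 + pi * s * t) ^ 4) \<partial>lborel)
     = (\<integral>\<^sup>+t. ennreal (s\<^sup>2) * ennreal (sinc (0 + pi * s * t) ^ 4) \<partial>lborel)"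
    by (intro nn_integral_cmult[symmetric] measurable_compose[OF _ measurable_ennreal]
       borel_measurable_continuous_onI continuous_intros) auto
  also have "\<dots> = (\<integral>\<^sup>+t. ennreal (tent_spectrum s t) \<partial>lborel)"
    by (intro nn_integral_cong)
       (simp add: tent_spectrum_def ennreal_mult[symmetric] power_mult_distrib flip: power_mult)
  also have "ennreal (s / pi) * ennreal (2 * pi / 3) = ennreal (2 * s / 3)"
    using s by (simp add: ennreal_mult[symmetric])
  finally show ?thesis by simp
qed

lemma abs_sinc_le: "\<bar>sinc y\<bar> \<le> 1" "\<bar>sinc y\<bar> * \<bar>y\<bar> \<le> 1"
  by (auto simp: abs_sin_x_le_abs_x)

text \<open>Since \<open>|sinc y|\<close> is at most \<open>1\<close> and at most \<open>1 / |y|\<close>, the spectrum decays like the inverse fourth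
  power, which leaves room for one moment.\<close>

lemma nn_integral_tent_spectrum_moment_finite:
  assumes s: "s > 0"
  shows "(\<integral>\<^sup>+t. ennreal (tent_spectrum s t * (1 + \<bar>t\<bar>)) \<partial>lborel) < \<infinity>"
proof -
  define c where "c = s\<^sup>2 * (1 + 1 / (pi * s)) ^ 4"
  have c0: "c \<ge> 0" by (simp add: c_def)
  have bd: "tent_spectrum s t * (1 + \<bar>t\<bar>) \<le> c * (1 / (1 + t) ^ 3)" if t: "t \<ge> 0" for t
  proof -
    have "\<bar>sinc (pi * s * t)\<bar> * t \<le> 1 / (pi * s)"
      using abs_sinc_le(2)[of "pi * s * t"] s t by (simp add: abs_mult field_simps)
    hence "\<bar>sinc (pi * s * t)\<bar> * (1 + t) \<le> 1 + 1 / (pi * s)"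
      using abs_sinc_le(1)[of "pi * s * t"] by (simp add: distrib_left del: abs_sinc_le)
    hence "(\<bar>sinc (pi * s * t)\<bar> * (1 + t)) ^ 4 \<le> (1 + 1 / (pi * s)) ^ 4"
      using t by (intro power_mono) auto
    hence "s\<^sup>2 * (sinc (pi * s * t) ^ 4 * (1 + t) ^ 4) \<le> c"
      unfolding c_def by (intro mult_left_mono) (auto simp: power_mult_distrib power_even_abs)
    hence "tent_spectrum s t * (1 + t) * (1 + t) ^ 3 \<le> c"
      by (simp add: tent_spectrum_def power_mult_distrib numeral_eq_Suc mult_ac)
    moreover have "(1 + t) ^ 3 > 0" using t by simp
    ultimately show ?thesis using t by (simp add: field_simps)
  qed
  have "(\<integral>\<^sup>+t. ennreal (tent_spectrum s t * (1 + \<bar>t\<bar>)) * indicator {0..} t \<partial>lborel)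
     \<le> (\<integral>\<^sup>+t. ennreal c * (ennreal (1 / (1 + t) ^ 3) * indicator {0..} t) \<partial>lborel)"
    using bd c0 by (intro nn_integral_mono) (auto split: split_indicator simp flip: ennreal_mult intro!: ennreal_leI)
  also have "\<dots> = ennreal c * (\<integral>\<^sup>+t. ennreal (1 / (1 + t) ^ 3) * indicator {0..} t \<partial>lborel)"
    by (intro nn_integral_cmult) measurable
  also have "(\<integral>\<^sup>+t. ennreal (1 / (1 + t) ^ 3) * indicator {0..} t \<partial>lborel) = ennreal (0 - (- 1 / (2 * (1 + 0)\<^sup>2)))"
  proof (rule nn_integral_FTC_atLeast)
    show "((\<lambda>t::real. - 1 / (2 * (1 + t)\<^sup>2)) \<longlongrightarrow> 0) at_top" by real_asymp
    show "((\<lambda>t::real. - 1 / (2 * (1 + t)\<^sup>2)) has_real_derivative 1 / (1 + t) ^ 3) (at t)" if "0 \<le> t" for t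
      apply (rule DERIV_cong, (rule derivative_eq_intros refl | use that in force)+)
      using that apply (simp add: divide_simps)
      apply algebra
      done
  qed auto
  finally have "(\<integral>\<^sup>+t. ennreal (tent_spectrum s t * (1 + \<bar>t\<bar>)) * indicator {0..} t \<partial>lborel) < \<infinity>"
    unfolding ennreal_mult'[OF c0, symmetric] infinity_ennreal_def
    by (rule order.strict_trans1[OF _ ennreal_less_top])
  moreover have "(\<integral>\<^sup>+t. ennreal (tent_spectrum s t * (1 + \<bar>t\<bar>)) \<partial>lborel)
     = 2 * (\<integral>\<^sup>+t. ennreal (tent_spectrum s t * (1 + \<bar>t\<bar>)) * indicator {0..} t \<partial>lborel)"
    by (rule nn_integral_even, measurable) (simp add: tent_spectrum_def)
  ultimately show ?thesis by (simp add: ennreal_mult_less_top)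
qed

section \<open>The test function in a cube and its power spectrum\<close>

lemma cmod_echar [simp]: "cmod (echar l x) = 1"
  by (simp add: echar_def)

lemma cnj_echar: "cnj (echar l x) = exp (- 2 * complex_of_real pi * \<i> * complex_of_real (x \<bullet> l))"
  by (simp add: echar_def exp_cnj)

lemma fourier_on_eq_inner: "fourier_on \<Omega> g l = L2_inner \<Omega> g (echar l)"
  by (simp add: fourier_on_def L2_inner_def cnj_echar)

lemma borel_measurable_echar [measurable]: "echar l \<in> borel_measurable borel"
  unfolding echar_def by (intro borel_measurable_continuous_onI continuous_intros)

lemma borel_measurable_lebesgue_on:
  "f \<in> borel_measurable borel \<Longrightarrow> f \<in> borel_measurable (lebesgue_on \<Omega>)"
  by (intro measurable_restrict_space1 measurable_completion) simp

lemma borel_measurable_cnj_echar [measurable]: "(\<lambda>x. cnj (echar l x)) \<in> borel_measurable borel"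
  unfolding cnj_echar by (intro borel_measurable_continuous_onI continuous_intros)

text \<open>Fubini's theorem for functions which are products over the coordinates. It reduces every
  statement about the test function to dimension one.\<close>

lemma has_bochner_integral_lborel_prod:
  fixes f :: "'a::euclidean_space \<Rightarrow> real \<Rightarrow> 'b::{real_normed_field,banach,second_countable_topology}"
  assumes f: "\<And>b. b \<in> Basis \<Longrightarrow> has_bochner_integral lborel (f b) (I b)"
  shows "has_bochner_integral lborel (\<lambda>x::'a. \<Prod>b\<in>Basis. f b (x \<bullet> b)) (\<Prod>b\<in>Basis. I b)"
proof -
  interpret product_sigma_finite "\<lambda>_::'a. lborel :: real measure" ..
  have i: "integrable lborel (f b)" and [measurable]: "f b \<in> borel_measurable borel"
    and I: "integral\<^sup>L lborel (f b) = I b" if "b \<in> Basis" for b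
    using f[OF that] by (auto simp: has_bochner_integral_iff dest: borel_measurable_integrable)
  have e: "(\<Prod>b\<in>Basis. f b ((\<Sum>c\<in>Basis. y c *\<^sub>R c) \<bullet> b)) = (\<Prod>b\<in>Basis. f b (y b))" for y
    by (intro prod.cong refl) simp
  have m: "(\<lambda>x::'a. \<Prod>b\<in>Basis. f b (x \<bullet> b)) \<in> borel_measurable borel"
    by measurable
  have "integrable (\<Pi>\<^sub>M b\<in>Basis. lborel) (\<lambda>y. \<Prod>b\<in>Basis. f b (y b))"
    by (intro product_integrable_prod i) auto
  moreover have "(\<integral>y. (\<Prod>b\<in>Basis. f b (y b)) \<partial>(\<Pi>\<^sub>M b\<in>Basis. lborel)) = (\<Prod>b\<in>Basis. I b)"
    by (subst product_integral_prod) (auto simp: i I)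
  ultimately show ?thesis
    unfolding has_bochner_integral_iff
    by (subst (1 2) lborel_eq) (simp add: integrable_distr_eq integral_distr m e)
qed

text \<open>The tensor product of tents, supported in the cube with centre \<open>a\<close> and half side \<open>s\<close>.\<close>

definition window :: "'a::euclidean_space \<Rightarrow> real \<Rightarrow> 'a \<Rightarrow> real" where
  "window a s x = (\<Prod>b\<in>Basis. tent s (x \<bullet> b - a \<bullet> b))"

definition window_spectrum :: "real \<Rightarrow> 'a::euclidean_space \<Rightarrow> real" where
  "window_spectrum s \<eta> = (\<Prod>b\<in>Basis. tent_spectrum s (\<eta> \<bullet> b))"

lemma window_spectrum_nonneg: "0 \<le> window_spectrum s \<eta>"
  unfolding window_spectrum_def by (intro prod_nonneg tent_spectrum_nonneg)

lemma continuous_on_window_spectrum: "continuous_on A (window_spectrum s)"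
  unfolding window_spectrum_def by (intro continuous_intros)

lemma borel_measurable_window_spectrum [measurable]: "window_spectrum s \<in> borel_measurable borel"
  by (intro borel_measurable_continuous_onI continuous_on_window_spectrum)

lemma window_spectrum_0_pos: "s > 0 \<Longrightarrow> window_spectrum s 0 > 0"
  unfolding window_spectrum_def by (intro prod_pos) (simp add: tent_spectrum_0)

lemma continuous_on_window: "continuous_on A (window a s)"
  unfolding window_def by (intro continuous_intros)

lemma borel_measurable_window [measurable]: "window a s \<in> borel_measurable borel"
  by (intro borel_measurable_continuous_onI continuous_on_window)

lemma window_eq_0:
  assumes "s > 0" "x \<notin> cbox (a - s *\<^sub>R One) (a + s *\<^sub>R One)"
  shows "window a s x = 0"
proof -
  obtain b :: 'a where "b \<in> Basis" "\<not> (a \<bullet> b - s \<le> x \<bullet> b \<and> x \<bullet> b \<le> a \<bullet> b + s)"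
    using assms(2) by (auto simp: mem_box inner_simps)
  then show ?thesis
    unfolding window_def using assms(1)
    by (intro prod_zero) (auto intro!: bexI[of _ b] tent_eq_0)
qed

lemma has_bochner_integral_window_squared:
  assumes s: "s > 0"
  shows "has_bochner_integral lborel (\<lambda>x::'a::euclidean_space. (window a s x)\<^sup>2) ((2 * s / 3) ^ DIM('a))"
proof -
  have "has_bochner_integral lborel (\<lambda>t. (tent s (t - c))\<^sup>2) (2 * s / 3)" for c
    using lborel_has_bochner_integral_real_affine_iff[of 1 "\<lambda>t. (tent s t)\<^sup>2" "2 * s / 3" "- c"]
      has_bochner_integral_tent_squared[OF s]
    by (simp add: add.commute)
  from has_bochner_integral_lborel_prod[of "\<lambda>b t. (tent s (t - a \<bullet> b))\<^sup>2" "\<lambda>_. 2 * s / 3", OF this]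
  show ?thesis
    by (simp add: window_def prod_power_distrib)
qed

lemma fourier_window:
  assumes s: "s > 0"
  shows "has_bochner_integral lborel
      (\<lambda>x::'a::euclidean_space. complex_of_real (window a s x) * exp (- 2 * complex_of_real pi * \<i> * complex_of_real (x \<bullet> \<eta>)))
      (\<Prod>b\<in>Basis. exp (- 2 * complex_of_real pi * \<i> * complex_of_real ((a \<bullet> b) * (\<eta> \<bullet> b)))
           * complex_of_real (s * (sinc (pi * s * (\<eta> \<bullet> b)))\<^sup>2))"
proof -
  let ?e = "\<lambda>t. exp (- 2 * complex_of_real pi * \<i> * complex_of_real t)"
  have "has_bochner_integral lborel (\<lambda>t. complex_of_real (tent s (t - c)) * ?e (t * y))
      (?e (c * y) * complex_of_real (s * (sinc (pi * s * y))\<^sup>2))" for c y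
  proof -
    have "has_bochner_integral lborel (\<lambda>t. complex_of_real (tent s (- c + 1 * t)) * ?e ((- c + 1 * t) * y))
       (complex_of_real (s * (sinc (pi * s * y))\<^sup>2))"
      using lborel_has_bochner_integral_real_affine_iff[of 1 "\<lambda>t. complex_of_real (tent s t) * ?e (t * y)"
          "complex_of_real (s * (sinc (pi * s * y))\<^sup>2)" "- c"] has_bochner_integral_tent_exp[OF s, of y]
      by simp
    from has_bochner_integral_mult_right[OF this, of "?e (c * y)"]
    have "has_bochner_integral lborel (\<lambda>t. ?e (c * y) * (complex_of_real (tent s (- c + 1 * t)) * ?e ((- c + 1 * t) * y)))
       (?e (c * y) * complex_of_real (s * (sinc (pi * s * y))\<^sup>2))" by blast
    also have "(\<lambda>t. ?e (c * y) * (complex_of_real (tent s (- c + 1 * t)) * ?e ((- c + 1 * t) * y)))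
      = (\<lambda>t. complex_of_real (tent s (t - c)) * ?e (t * y))"
    proof
      fix t
      have "?e (c * y) * ?e ((- c + 1 * t) * y) = ?e (t * y)"
        by (simp flip: exp_add) (simp add: algebra_simps)
      then show "?e (c * y) * (complex_of_real (tent s (- c + 1 * t)) * ?e ((- c + 1 * t) * y))
          = complex_of_real (tent s (t - c)) * ?e (t * y)"
        by (simp add: mult_ac)
    qed
    finally show ?thesis .
  qed
  from has_bochner_integral_lborel_prod[of "\<lambda>b t. complex_of_real (tent s (t - a \<bullet> b)) * ?e (t * (\<eta> \<bullet> b))", OF this]
  have "has_bochner_integral lborel (\<lambda>x. \<Prod>b\<in>Basis. complex_of_real (tent s (x \<bullet> b - a \<bullet> b)) * ?e (x \<bullet> b * (\<eta> \<bullet> b)))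
     (\<Prod>b\<in>Basis. ?e ((a \<bullet> b) * (\<eta> \<bullet> b)) * complex_of_real (s * (sinc (pi * s * (\<eta> \<bullet> b)))\<^sup>2))" by blast
  also have "(\<lambda>x. \<Prod>b\<in>Basis. complex_of_real (tent s (x \<bullet> b - a \<bullet> b)) * ?e (x \<bullet> b * (\<eta> \<bullet> b)))
     = (\<lambda>x. complex_of_real (window a s x) * ?e (x \<bullet> \<eta>))"
  proof
    fix x :: 'a
    have "(\<Prod>b\<in>Basis. ?e (x \<bullet> b * (\<eta> \<bullet> b))) = exp (\<Sum>b\<in>Basis. - 2 * complex_of_real pi * \<i> * complex_of_real (x \<bullet> b * (\<eta> \<bullet> b)))"
      by (rule exp_sum[symmetric]) simp
    also have "\<dots> = ?e (x \<bullet> \<eta>)"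
      by (simp only: euclidean_inner[of x \<eta>] of_real_sum sum_distrib_left)
    finally show "(\<Prod>b\<in>Basis. complex_of_real (tent s (x \<bullet> b - a \<bullet> b)) * ?e (x \<bullet> b * (\<eta> \<bullet> b)))
        = complex_of_real (window a s x) * ?e (x \<bullet> \<eta>)"
      by (simp only: window_def prod.distrib of_real_prod)
  qed
  finally show ?thesis .
qed

text \<open>What the frame inequality needs to know about the test function: its norm does not change under
  modulation, and modulation by \<open>\<xi>\<close> translates the power spectrum by \<open>\<xi>\<close>.\<close>

lemma modulated_window_in_L2:
  fixes \<Omega> :: "'a::euclidean_space set"
  assumes s: "s > 0" and \<Omega>: "open \<Omega>" "cbox (a - s *\<^sub>R One) (a + s *\<^sub>R One) \<subseteq> \<Omega>"
  shows "(\<lambda>x. complex_of_real (window a s x) * echar \<xi> x) \<in> L2 \<Omega>"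
    and "(L2_norm \<Omega> (\<lambda>x. complex_of_real (window a s x) * echar \<xi> x))\<^sup>2 = (2 * s / 3) ^ DIM('a)"
    and "(cmod (fourier_on \<Omega> (\<lambda>x. complex_of_real (window a s x) * echar \<xi> x) l))\<^sup>2 = window_spectrum s (l - \<xi>)"
proof -
  have z: "window a s x = 0" if "x \<notin> \<Omega>" for x
    using that \<Omega>(2) by (intro window_eq_0 s) auto
  have ms: "\<Omega> \<inter> space lebesgue \<in> sets lebesgue" using \<Omega>(1) by (simp add: borel_open)
  have h: "has_bochner_integral (lebesgue_on \<Omega>) f I \<longleftrightarrow> has_bochner_integral lborel f I"
    if "\<And>x. x \<notin> \<Omega> \<Longrightarrow> f x = 0" "f \<in> borel_measurable borel"
    for f :: "'a \<Rightarrow> 'b::{banach,second_countable_topology}" and I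
  proof -
    have "(\<lambda>x. indicator \<Omega> x *\<^sub>R f x) = f" using that(1) by (auto split: split_indicator)
    then show ?thesis
      using that(2) unfolding has_bochner_integral_iff
      by (simp add: integrable_restrict_space[OF ms] integral_restrict_space[OF ms]
         integrable_completion integral_completion)
  qed
  have sq: "has_bochner_integral (lebesgue_on \<Omega>) (\<lambda>x. (window a s x)\<^sup>2) ((2 * s / 3) ^ DIM('a))"
    using has_bochner_integral_window_squared[OF s, of a] by (subst h) (auto simp: z)
  have cm: "(cmod (complex_of_real (window a s x) * echar \<xi> x))\<^sup>2 = (window a s x)\<^sup>2" for x
    by (simp add: norm_mult)
  show "(\<lambda>x. complex_of_real (window a s x) * echar \<xi> x) \<in> L2 \<Omega>"
    unfolding L2_def using sq
    by (auto simp: cm has_bochner_integral_iff intro!: borel_measurable_lebesgue_on)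
  show "(L2_norm \<Omega> (\<lambda>x. complex_of_real (window a s x) * echar \<xi> x))\<^sup>2 = (2 * s / 3) ^ DIM('a)"
    unfolding L2_norm_def cm using sq s by (simp add: has_bochner_integral_iff)
  let ?e = "\<lambda>t. exp (- 2 * complex_of_real pi * \<i> * complex_of_real t)"
  have cm': "(cmod (?e u * complex_of_real v))\<^sup>2 = v\<^sup>2" for u v
    by (simp add: norm_mult)
  have p: "complex_of_real (window a s x) * echar \<xi> x * ?e (x \<bullet> l) = complex_of_real (window a s x) * ?e (x \<bullet> (l - \<xi>))" for x
    unfolding echar_def mult.assoc by (simp flip: exp_add add: inner_diff_right algebra_simps)
  have "fourier_on \<Omega> (\<lambda>x. complex_of_real (window a s x) * echar \<xi> x) l =
     (\<Prod>b\<in>Basis. ?e ((a \<bullet> b) * ((l - \<xi>) \<bullet> b)) * complex_of_real (s * (sinc (pi * s * ((l - \<xi>) \<bullet> b)))\<^sup>2))"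
    unfolding fourier_on_def p
    by (intro has_bochner_integral_integral_eq h[THEN iffD2] fourier_window[OF s]
        borel_measurable_continuous_onI continuous_intros continuous_on_window)
      (simp add: z)
  also have "(cmod \<dots>)\<^sup>2 = window_spectrum s (l - \<xi>)"
    unfolding window_spectrum_def prod_norm[symmetric] prod_power_distrib tent_spectrum_def
    by (intro prod.cong refl, rule cm')
  finally show "(cmod (fourier_on \<Omega> (\<lambda>x. complex_of_real (window a s x) * echar \<xi> x) l))\<^sup>2 = window_spectrum s (l - \<xi>)" .
qed

text \<open>Plancherel's identity for the test function; compare the norm in \<open>modulated_window_in_L2\<close>.\<close>

lemma nn_integral_window_spectrum:
  assumes s: "s > 0"
  shows "(\<integral>\<^sup>+\<eta>. ennreal (window_spectrum s \<eta>) \<partial>(lborel :: 'a::euclidean_space measure)) = ennreal ((2 * s / 3) ^ DIM('a))"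
proof -
  have "(\<integral>\<^sup>+\<eta>. ennreal (window_spectrum s \<eta>) \<partial>(lborel :: 'a measure)) = (\<integral>\<^sup>+\<eta>. (\<Prod>b\<in>Basis. ennreal (tent_spectrum s (\<eta> \<bullet> b))) \<partial>(lborel :: 'a measure))"
    by (simp add: window_spectrum_def prod_ennreal tent_spectrum_nonneg)
  also have "\<dots> = (\<Prod>b\<in>(Basis :: 'a set). \<integral>\<^sup>+t. ennreal (tent_spectrum s t) \<partial>lborel)"
    by (rule nn_integral_lborel_prod) auto
  finally show ?thesis
    using s by (simp add: nn_integral_tent_spectrum ennreal_power)
qed

lemma one_plus_sum_le_prod:
  fixes f :: "'b \<Rightarrow> real"
  assumes "finite A" "\<And>x. x \<in> A \<Longrightarrow> 0 \<le> f x"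
  shows "1 + sum f A \<le> (\<Prod>x\<in>A. 1 + f x)"
  using assms
proof (induction A rule: finite_induct)
  case (insert x A)
  have "1 + (f x + sum f A) \<le> (1 + f x) * (1 + sum f A)"
    using insert.prems by (simp add: algebra_simps sum_nonneg)
  also have "\<dots> \<le> (1 + f x) * (\<Prod>x\<in>A. 1 + f x)"
    using insert by (intro mult_left_mono) auto
  finally show ?case using insert by simp
qed simp

text \<open>The factor \<open>1 + norm \<eta>\<close> is dominated by the product of the factors \<open>1 + |\<eta> \<bullet> b|\<close>, so that the
  integral splits into one-dimensional moments.\<close>

lemma nn_integral_window_spectrum_moment_finite:
  assumes s: "s > 0"
  shows "(\<integral>\<^sup>+\<eta>. ennreal (window_spectrum s \<eta> * (1 + norm \<eta>)) \<partial>(lborel :: 'a::euclidean_space measure)) < \<infinity>"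
proof -
  have "1 + norm \<eta> \<le> (\<Prod>b\<in>Basis. 1 + \<bar>\<eta> \<bullet> b\<bar>)" for \<eta> :: 'a
  proof -
    have "1 + norm \<eta> \<le> 1 + (\<Sum>b\<in>Basis. \<bar>\<eta> \<bullet> b\<bar>)" using norm_le_l1[of \<eta>] by simp
    also have "\<dots> \<le> (\<Prod>b\<in>Basis. 1 + \<bar>\<eta> \<bullet> b\<bar>)" by (rule one_plus_sum_le_prod) auto
    finally show ?thesis .
  qed
  then have "(\<integral>\<^sup>+\<eta>. ennreal (window_spectrum s \<eta> * (1 + norm \<eta>)) \<partial>(lborel :: 'a measure))
      \<le> (\<integral>\<^sup>+\<eta>. ennreal (window_spectrum s \<eta> * (\<Prod>b\<in>Basis. 1 + \<bar>\<eta> \<bullet> b\<bar>)) \<partial>(lborel :: 'a measure))"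
    by (intro nn_integral_mono ennreal_leI mult_left_mono window_spectrum_nonneg) auto
  also have "\<dots> = (\<integral>\<^sup>+\<eta>. (\<Prod>b\<in>Basis. ennreal (tent_spectrum s (\<eta> \<bullet> b) * (1 + \<bar>\<eta> \<bullet> b\<bar>))) \<partial>(lborel :: 'a measure))"
    by (simp add: window_spectrum_def prod_ennreal tent_spectrum_nonneg prod.distrib)
  also have "\<dots> = (\<Prod>b\<in>(Basis :: 'a set). \<integral>\<^sup>+t. ennreal (tent_spectrum s t * (1 + \<bar>t\<bar>)) \<partial>lborel)"
    by (rule nn_integral_lborel_prod) auto
  also have "\<dots> < \<infinity>"
    using nn_integral_tent_spectrum_moment_finite[OF s] by (simp add: less_top[symmetric] power_eq_top_ennreal)
  finally show ?thesis .
qed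

section \<open>Orthogonal bases of exponentials satisfy the Parseval identity\<close>

lemma L2_imp_integrable:
  assumes \<Omega>: "\<Omega> \<in> lmeasurable" and g: "g \<in> L2 \<Omega>"
  shows "integrable (lebesgue_on \<Omega>) g"
proof -
  interpret finite_measure "lebesgue_on \<Omega>"
    by (rule finite_measure_lebesgue_on[OF \<Omega>])
  have "norm (g x) \<le> norm (1 + (cmod (g x))\<^sup>2)" for x
  proof -
    have "2 * cmod (g x) \<le> 1 + (cmod (g x))\<^sup>2"
      using sum_squares_bound[of 1 "cmod (g x)"] by simp
    then have "cmod (g x) \<le> 1 + (cmod (g x))\<^sup>2"
      using norm_ge_zero[of "g x"] by linarith
    then show ?thesis by simp
  qed
  then show ?thesis
    using g by - (rule Bochner_Integration.integrable_bound[where f = "\<lambda>x. 1 + (cmod (g x))\<^sup>2"],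
      auto simp: L2_def)
qed

lemma integrable_L2_mult_bounded:
  assumes \<Omega>: "\<Omega> \<in> lmeasurable" and g: "g \<in> L2 \<Omega>"
    and h: "h \<in> borel_measurable (lebesgue_on \<Omega>)" "\<And>x. cmod (h x) \<le> 1"
  shows "integrable (lebesgue_on \<Omega>) (\<lambda>x. g x * h x)"
  using L2_imp_integrable[OF \<Omega> g] g h
  by - (rule Bochner_Integration.integrable_bound[where f = g],
     auto simp: L2_def norm_mult intro!: mult_left_le AE_I2)

lemma echar_inner_self:
  assumes \<Omega>: "\<Omega> \<in> lmeasurable"
  shows "L2_inner \<Omega> (echar l) (echar l) = complex_of_real (measure lebesgue \<Omega>)"
proof -
  have "L2_inner \<Omega> (echar l) (echar l) = integral\<^sup>L (lebesgue_on \<Omega>) (\<lambda>x. 1)"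
    unfolding L2_inner_def
    by (simp flip: complex_norm_square)
  then show ?thesis
    using \<Omega> by (simp add: measure_restrict_space fmeasurableD scaleR_conv_of_real)
qed

lemma L2_norm_squared: "(L2_norm \<Omega> g)\<^sup>2 = integral\<^sup>L (lebesgue_on \<Omega>) (\<lambda>x. (cmod (g x))\<^sup>2)"
  unfolding L2_norm_def by (intro real_sqrt_pow2 Bochner_Integration.integral_nonneg) auto

text \<open>Pythagoras: the error of an approximation by exponentials is the minimal one plus the squared
  deviation of the coefficients from the Fourier coefficients. Taking the Fourier coefficients gives
  Bessel's inequality; density of the span gives the reverse bound.\<close>

lemma L2_norm_expansion:
  fixes \<Omega> :: "'a::euclidean_space set"
  assumes \<Omega>: "\<Omega> \<in> lmeasurable" "measure lebesgue \<Omega> > 0" and g: "g \<in> L2 \<Omega>" and F: "finite F"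
    and orth: "\<And>l m. l \<in> F \<Longrightarrow> m \<in> F \<Longrightarrow> l \<noteq> m \<Longrightarrow> L2_inner \<Omega> (echar l) (echar m) = 0"
  shows "(L2_norm \<Omega> (\<lambda>x. g x - (\<Sum>l\<in>F. c l * echar l x)))\<^sup>2 =
     (L2_norm \<Omega> g)\<^sup>2 - (\<Sum>l\<in>F. (cmod (fourier_on \<Omega> g l))\<^sup>2) / measure lebesgue \<Omega>
     + measure lebesgue \<Omega> * (\<Sum>l\<in>F. (cmod (c l - fourier_on \<Omega> g l / measure lebesgue \<Omega>))\<^sup>2)"
proof -
  define M where "M = lebesgue_on \<Omega>"
  define m where "m = measure lebesgue \<Omega>"
  define q where "q = fourier_on \<Omega> g"
  define P where "P = (\<lambda>x. \<Sum>l\<in>F. c l * echar l x)"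
  interpret finite_measure M
    unfolding M_def by (rule finite_measure_lebesgue_on[OF \<Omega>(1)])
  have e[measurable]: "echar l \<in> borel_measurable M" for l
    unfolding M_def by (intro borel_measurable_lebesgue_on) measurable
  have [measurable]: "(\<lambda>x. cnj (echar l x)) \<in> borel_measurable M" for l
    unfolding M_def by (intro borel_measurable_lebesgue_on) measurable
  have gm[measurable]: "g \<in> borel_measurable M" using g by (simp add: L2_def M_def)
  have i1: "integrable M (\<lambda>x. g x * cnj (echar l x))" for l
    unfolding M_def by (intro integrable_L2_mult_bounded \<Omega> g borel_measurable_lebesgue_on) auto
  have i2: "integrable M (\<lambda>x. echar l x * cnj (echar k x))" for l k
    by (rule integrable_const_bound[where B = 1]) (auto simp: norm_mult)
  have i0: "integrable M (\<lambda>x. (cmod (g x))\<^sup>2)" using g by (simp add: L2_def M_def)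
  have q: "q l = integral\<^sup>L M (\<lambda>x. g x * cnj (echar l x))" for l
    by (simp add: q_def fourier_on_eq_inner L2_inner_def M_def)
  have o: "integral\<^sup>L M (\<lambda>x. echar l x * cnj (echar k x)) = (if l = k then complex_of_real m else 0)"
    if "l \<in> F" "k \<in> F" for l k
    using orth[OF that] echar_inner_self[OF \<Omega>(1), of l]
    by (auto simp: L2_inner_def M_def m_def)
  have b1: "has_bochner_integral M (\<lambda>x. g x * cnj (echar l x)) (q l)" for l
    using i1[of l] by (simp add: has_bochner_integral_iff q)
  have b2: "has_bochner_integral M (\<lambda>x. echar l x * cnj (echar k x)) (if l = k then complex_of_real m else 0)"
    if "l \<in> F" "k \<in> F" for l k
    using i2[of l k] o[OF that] by (simp add: has_bochner_integral_iff)
  have b3: "has_bochner_integral M (\<lambda>x. cnj (g x) * echar l x) (cnj (q l))" for l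
    using has_bochner_integral_cnj[OF b1[of l]] by simp
  have pt: "complex_of_real ((cmod (g x - P x))\<^sup>2) = complex_of_real ((cmod (g x))\<^sup>2)
      - (\<Sum>l\<in>F. cnj (c l) * (g x * cnj (echar l x))) - (\<Sum>l\<in>F. c l * (cnj (g x) * echar l x))
      + (\<Sum>l\<in>F. \<Sum>k\<in>F. c l * cnj (c k) * (echar l x * cnj (echar k x)))" for x
  proof -
    have "complex_of_real ((cmod (g x - P x))\<^sup>2) = (g x - P x) * cnj (g x - P x)"
      by (rule complex_norm_square)
    also have "\<dots> = g x * cnj (g x) - g x * cnj (P x) - P x * cnj (g x) + P x * cnj (P x)"
      by (simp add: algebra_simps)
    also have "g x * cnj (g x) = complex_of_real ((cmod (g x))\<^sup>2)"
      by (rule complex_norm_square[symmetric])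
    also have "g x * cnj (P x) = (\<Sum>l\<in>F. cnj (c l) * (g x * cnj (echar l x)))"
      unfolding P_def cnj_sum sum_distrib_left by (intro sum.cong refl) (simp add: mult_ac)
    also have "P x * cnj (g x) = (\<Sum>l\<in>F. c l * (cnj (g x) * echar l x))"
      unfolding P_def sum_distrib_right by (intro sum.cong refl) (simp add: mult_ac)
    also have "P x * cnj (P x) = (\<Sum>l\<in>F. \<Sum>k\<in>F. c l * cnj (c k) * (echar l x * cnj (echar k x)))"
      unfolding P_def cnj_sum sum_product by (intro sum.cong refl) (simp add: mult_ac)
    finally show ?thesis .
  qed
  have "complex_of_real (integral\<^sup>L M (\<lambda>x. (cmod (g x - P x))\<^sup>2))
      = integral\<^sup>L M (\<lambda>x. complex_of_real ((cmod (g x - P x))\<^sup>2))"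
    by (rule integral_complex_of_real[symmetric])
  also have "\<dots> = complex_of_real (integral\<^sup>L M (\<lambda>x. (cmod (g x))\<^sup>2))
     - (\<Sum>l\<in>F. cnj (c l) * q l) - (\<Sum>l\<in>F. c l * cnj (q l))
     + (\<Sum>l\<in>F. \<Sum>k\<in>F. c l * cnj (c k) * (if l = k then complex_of_real m else 0))"
    unfolding pt
    by (intro has_bochner_integral_integral_eq has_bochner_integral_add has_bochner_integral_diff
        has_bochner_integral_sum has_bochner_integral_mult_right has_bochner_integral_of_real
        has_bochner_integral_integrable[OF i0] b1 b2 b3)
  also have "(\<Sum>l\<in>F. \<Sum>k\<in>F. c l * cnj (c k) * (if l = k then complex_of_real m else 0))
     = (\<Sum>l\<in>F. c l * cnj (c l) * m)"
    using F by (intro sum.cong refl) (simp add: if_distrib cong: if_cong)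
  also have "complex_of_real (integral\<^sup>L M (\<lambda>x. (cmod (g x))\<^sup>2))
     - (\<Sum>l\<in>F. cnj (c l) * q l) - (\<Sum>l\<in>F. c l * cnj (q l)) + (\<Sum>l\<in>F. c l * cnj (c l) * m)
    = complex_of_real (integral\<^sup>L M (\<lambda>x. (cmod (g x))\<^sup>2))
      + (\<Sum>l\<in>F. c l * cnj (c l) * m - cnj (c l) * q l - c l * cnj (q l))"
    by (simp add: sum_subtractf)
  also have "(\<Sum>l\<in>F. c l * cnj (c l) * m - cnj (c l) * q l - c l * cnj (q l))
     = (\<Sum>l\<in>F. complex_of_real (m * (cmod (c l - q l / m))\<^sup>2 - (cmod (q l))\<^sup>2 / m))"
  proof (rule sum.cong[OF refl])
    fix l
    have m: "complex_of_real m \<noteq> 0" using \<Omega>(2) by (simp add: m_def)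
    show "c l * cnj (c l) * m - cnj (c l) * q l - c l * cnj (q l)
      = complex_of_real (m * (cmod (c l - q l / m))\<^sup>2 - (cmod (q l))\<^sup>2 / m)"
      unfolding of_real_diff of_real_mult of_real_divide complex_norm_square
      using m by (simp add: field_simps)
  qed
  finally have "integral\<^sup>L M (\<lambda>x. (cmod (g x - P x))\<^sup>2) = integral\<^sup>L M (\<lambda>x. (cmod (g x))\<^sup>2)
     + (\<Sum>l\<in>F. m * (cmod (c l - q l / m))\<^sup>2 - (cmod (q l))\<^sup>2 / m)"
    unfolding of_real_sum[symmetric] of_real_add[symmetric] of_real_eq_iff .
  then show ?thesis
    unfolding L2_norm_squared
    by (simp add: P_def M_def q_def m_def sum_subtractf sum_distrib_left sum_divide_distrib)
qed

lemma infsum_ennreal_eq_SUP: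
  "(\<Sum>\<^sub>\<infinity>l\<in>A. (f l :: ennreal)) = (SUP F\<in>{F. finite F \<and> F \<subseteq> A}. sum f F)"
  by (rule nonneg_infsum_complete) simp

lemma exp_orthogonal_basis_imp_frame:
  fixes \<Omega> :: "'a::euclidean_space set"
  assumes \<Omega>: "\<Omega> \<in> lmeasurable" "measure lebesgue \<Omega> > 0" and basis: "exp_orthogonal_basis \<Omega> \<Lambda>"
  shows "exp_frame \<Omega> \<Lambda> 1 1"
proof -
  define m where "m = measure lebesgue \<Omega>"
  have m: "m > 0" using \<Omega> by (simp add: m_def)
  have orth: "L2_inner \<Omega> (echar l) (echar k) = 0" if "l \<in> \<Lambda>" "k \<in> \<Lambda>" "l \<noteq> k" for l k
    using basis that unfolding exp_orthogonal_basis_def by blast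
  have "ennreal (m * (L2_norm \<Omega> g)\<^sup>2) = (\<Sum>\<^sub>\<infinity>l\<in>\<Lambda>. ennreal ((cmod (fourier_on \<Omega> g l))\<^sup>2))"
    if g: "g \<in> L2 \<Omega>" for g
  proof -
    define q where "q = (\<lambda>l. (cmod (fourier_on \<Omega> g l))\<^sup>2)"
    have exp: "(L2_norm \<Omega> (\<lambda>x. g x - (\<Sum>l\<in>F. c l * echar l x)))\<^sup>2 =
        (L2_norm \<Omega> g)\<^sup>2 - sum q F / m + m * (\<Sum>l\<in>F. (cmod (c l - fourier_on \<Omega> g l / m))\<^sup>2)"
      if "finite F" "F \<subseteq> \<Lambda>" for F c
      unfolding q_def m_def using orth that by (intro L2_norm_expansion \<Omega> g) blast+
    have "(SUP F\<in>{F. finite F \<and> F \<subseteq> \<Lambda>}. (\<Sum>l\<in>F. ennreal (q l))) = ennreal (m * (L2_norm \<Omega> g)\<^sup>2)"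
    proof (rule antisym)
      show "(SUP F\<in>{F. finite F \<and> F \<subseteq> \<Lambda>}. (\<Sum>l\<in>F. ennreal (q l))) \<le> ennreal (m * (L2_norm \<Omega> g)\<^sup>2)"
      proof (rule SUP_least)
        fix F assume F: "F \<in> {F. finite F \<and> F \<subseteq> \<Lambda>}"
        have "0 \<le> (L2_norm \<Omega> g)\<^sup>2 - sum q F / m"
        proof -
          have "(L2_norm \<Omega> (\<lambda>x. g x - (\<Sum>l\<in>F. fourier_on \<Omega> g l / m * echar l x)))\<^sup>2 = (L2_norm \<Omega> g)\<^sup>2 - sum q F / m"
            using exp[of F "\<lambda>l. fourier_on \<Omega> g l / m"] F by simp
          then show ?thesis by (metis zero_le_power2)
        qed
        hence "sum q F \<le> m * (L2_norm \<Omega> g)\<^sup>2" using m by (simp add: field_simps)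
        then show "(\<Sum>l\<in>F. ennreal (q l)) \<le> ennreal (m * (L2_norm \<Omega> g)\<^sup>2)"
          by (subst sum_ennreal) (auto simp: q_def intro: ennreal_leI)
      qed
    next
      show "ennreal (m * (L2_norm \<Omega> g)\<^sup>2) \<le> (SUP F\<in>{F. finite F \<and> F \<subseteq> \<Lambda>}. (\<Sum>l\<in>F. ennreal (q l)))"
      proof (rule ennreal_le_epsilon)
        fix e :: real assume e: "e > 0"
        \<comment> \<open>The accuracy is chosen so that its square times the measure of the domain is \<open>e\<close>.\<close>
        obtain F c where F: "finite F" "F \<subseteq> \<Lambda>"
          and less: "L2_norm \<Omega> (\<lambda>x. g x - (\<Sum>l\<in>F. c l * echar l x)) < sqrt (e / m)"
          using basis g e m unfolding exp_orthogonal_basis_def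
          by (meson divide_pos_pos real_sqrt_gt_zero)
        have "(L2_norm \<Omega> (\<lambda>x. g x - (\<Sum>l\<in>F. c l * echar l x)))\<^sup>2 \<le> (sqrt (e / m))\<^sup>2"
          using less by (intro power_mono) (auto simp: L2_norm_def)
        moreover have "0 \<le> m * (\<Sum>l\<in>F. (cmod (c l - fourier_on \<Omega> g l / m))\<^sup>2)"
          using m by (auto intro!: mult_nonneg_nonneg sum_nonneg)
        ultimately have "(L2_norm \<Omega> g)\<^sup>2 - sum q F / m \<le> e / m"
          using exp[OF F, of c] e m by simp
        hence "(L2_norm \<Omega> g)\<^sup>2 \<le> (sum q F + e) / m" by (simp add: add_divide_distrib)
        hence "m * (L2_norm \<Omega> g)\<^sup>2 \<le> sum q F + e" using m by (simp add: pos_le_divide_eq mult.commute)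
        hence "ennreal (m * (L2_norm \<Omega> g)\<^sup>2) \<le> ennreal (sum q F) + ennreal e"
          using e by (subst ennreal_plus[symmetric]) (auto simp: q_def intro!: sum_nonneg ennreal_leI)
        also have "ennreal (sum q F) = (\<Sum>l\<in>F. ennreal (q l))"
          by (subst sum_ennreal) (auto simp: q_def)
        also have "\<dots> \<le> (SUP F\<in>{F. finite F \<and> F \<subseteq> \<Lambda>}. (\<Sum>l\<in>F. ennreal (q l)))"
          using F by (intro SUP_upper) auto
        finally show "ennreal (m * (L2_norm \<Omega> g)\<^sup>2)
            \<le> (SUP F\<in>{F. finite F \<and> F \<subseteq> \<Lambda>}. (\<Sum>l\<in>F. ennreal (q l))) + ennreal e"
          by (simp add: add_right_mono)
      qed
    qed
    then show ?thesis
      by (simp add: infsum_ennreal_eq_SUP q_def)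
  qed
  then show ?thesis
    unfolding exp_frame_def m_def by simp
qed

section \<open>Dilates of a convex body and points near their boundary\<close>

abbreviation dilate :: "real \<Rightarrow> 'a::euclidean_space set \<Rightarrow> 'a set" where
  "dilate t K \<equiv> (\<lambda>y. t *\<^sub>R y) ` K"

text \<open>A ball about an interior point \<open>x\<close> and its mirror image about \<open>- x\<close> average to a ball about the
  origin.\<close>

lemma symmetric_convex_body_contains_cball:
  assumes K: "convex_body K" "\<forall>x\<in>K. - x \<in> K"
  obtains e where "e > 0" "cball 0 e \<subseteq> K"
proof -
  have conv: "convex K" using K by (simp add: convex_body_def)
  obtain x e where e: "e > 0" "ball x e \<subseteq> K"
    using K unfolding convex_body_def by (meson ex_in_conv mem_interior)
  have "y \<in> K" if "y \<in> cball 0 (e / 2)" for y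
  proof -
    have "x + y \<in> K" "x - y \<in> K"
      using that e by (auto intro!: subsetD[OF e(2)] simp: dist_norm)
    hence "(1/2) *\<^sub>R (x + y) + (1/2) *\<^sub>R (- (x - y)) \<in> K"
      using K(2) by (intro convexD[OF conv]) auto
    then show ?thesis by (simp add: algebra_simps flip: scaleR_add_left)
  qed
  hence "cball 0 (e / 2) \<subseteq> K" by blast
  then show thesis using that[of "e / 2"] e(1) by linarith
qed

lemma dilate_mono:
  assumes K: "convex K" "0 \<in> K" and st: "0 \<le> s" "s \<le> t"
  shows "dilate s K \<subseteq> dilate t K"
proof (cases "t = 0")
  case False
  show ?thesis
  proof
    fix x assume "x \<in> dilate s K"
    then obtain y where y: "y \<in> K" "x = s *\<^sub>R y" by auto
    have "(1 - s / t) *\<^sub>R 0 + (s / t) *\<^sub>R y \<in> K"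
      using K y st False by (intro convexD) auto
    hence "(s / t) *\<^sub>R y \<in> K" by simp
    moreover have "x = t *\<^sub>R ((s / t) *\<^sub>R y)" using y False by simp
    ultimately show "x \<in> dilate t K" by blast
  qed
qed (use st in auto)

lemma dilate_add:
  assumes K: "convex K" and st: "0 \<le> s" "0 \<le> t" and x: "x \<in> dilate s K" and y: "y \<in> dilate t K"
  shows "x + y \<in> dilate (s + t) K"
proof (cases "s + t = 0")
  case False
  obtain u v where uv: "u \<in> K" "v \<in> K" "x = s *\<^sub>R u" "y = t *\<^sub>R v" using x y by auto
  have "(s / (s + t)) *\<^sub>R u + (t / (s + t)) *\<^sub>R v \<in> K"
    using st False uv by (intro convexD[OF K]) (auto simp flip: add_divide_distrib)
  moreover have "x + y = (s + t) *\<^sub>R ((s / (s + t)) *\<^sub>R u + (t / (s + t)) *\<^sub>R v)"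
    using uv False by (simp add: scaleR_add_right)
  ultimately show ?thesis by blast
qed (use st x y in \<open>auto simp: add_nonneg_eq_0_iff\<close>)

lemma cball_subset_dilate:
  assumes "e > 0" "cball 0 e \<subseteq> K" "norm x \<le> t * e"
  shows "x \<in> dilate t K"
proof (cases "t = 0")
  case True
  have "0 \<in> K" using assms by auto
  then show ?thesis using assms True by auto
next
  case False
  hence "t > 0" using assms norm_ge_zero[of x] by (smt (verit) mult_nonpos_nonneg zero_less_mult_pos2 mult_neg_pos)
  hence "(1 / t) *\<^sub>R x \<in> K" "x = t *\<^sub>R ((1 / t) *\<^sub>R x)"
    using assms by (auto intro!: subsetD[OF assms(2)] simp: field_simps)
  then show ?thesis by blast
qed

text \<open>The infimum defining the norm need not be attained, but if it is at most \<open>R\<close>, then \<open>x\<close> belongs to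
  every dilate by more than \<open>R\<close>, and \<open>K\<close> is closed; hence the counting region is exactly the dilate by \<open>R\<close>.\<close>

lemma body_norm_le_iff:
  assumes K: "compact K" "convex K" and e: "e > 0" "cball 0 e \<subseteq> K" and R: "R > 0"
  shows "body_norm K x \<le> R \<longleftrightarrow> x \<in> dilate R K"
proof
  let ?S = "{t. t > 0 \<and> x \<in> dilate t K}"
  have bdd: "bdd_below ?S" by (rule bdd_belowI[of _ 0]) auto
  {
    assume "x \<in> dilate R K"
    then show "body_norm K x \<le> R"
      unfolding body_norm_def using R by (intro cInf_lower bdd) auto
  next
    assume le: "body_norm K x \<le> R"
    have K0: "0 \<in> K" using e by auto
    have "norm x / e + 1 \<in> ?S"
      using e by (auto intro!: cball_subset_dilate[OF e] simp: field_simps add_pos_nonneg)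
    hence ne: "?S \<noteq> {}" by blast
    have in_K: "(1 / t) *\<^sub>R x \<in> K" if "t > R" for t
    proof -
      have "Inf ?S < t" using le that by (simp add: body_norm_def)
      then obtain t' where "t' \<in> ?S" "t' < t" using cInf_lessD[OF ne] by blast
      hence "x \<in> dilate t K" using dilate_mono[OF K(2) K0, of t' t] by auto
      then show ?thesis using that R by auto
    qed
    have "(\<lambda>n. (1 / (R + 1 / real (Suc n))) *\<^sub>R x) \<longlonglongrightarrow> (1 / (R + 0)) *\<^sub>R x"
      using R by (intro tendsto_intros LIMSEQ_Suc[OF lim_1_over_n]) auto
    hence "(1 / (R + 0)) *\<^sub>R x \<in> K"
      by (rule closed_sequentially[OF compact_imp_closed[OF K(1)], rotated]) (auto intro!: in_K)
    moreover have "x = R *\<^sub>R ((1 / (R + 0)) *\<^sub>R x)" using R by simp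
    ultimately show "x \<in> dilate R K" by blast
  }
qed

lemma emeasure_dilate:
  fixes K :: "'a::euclidean_space set"
  assumes "compact K" "0 \<le> t"
  shows "emeasure lborel (dilate t K) = ennreal (t ^ DIM('a) * measure lebesgue K)"
proof -
  have c: "compact (dilate t K)" using assms(1) by (rule compact_scaling)
  have "emeasure lborel (dilate t K) = emeasure lebesgue (dilate t K)"
    using c by (simp add: borel_compact)
  also have "\<dots> = ennreal t ^ DIM('a) * emeasure lebesgue K"
    using emeasure_lebesgue_affine[of t 0 K] assms(2) by (simp add: ennreal_power)
  also have "emeasure lebesgue K = ennreal (measure lebesgue K)"
    using assms(1) by (simp add: emeasure_eq_measure2 lmeasurable_compact)
  finally show ?thesis
    using assms(2) by (simp add: ennreal_power ennreal_mult)
qed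

text \<open>The mean value bound for the power function; it turns the volume of a shell into its thickness
  times \<open>p ^ (n - 1)\<close>.\<close>

lemma power_diff_le:
  fixes p q :: real
  assumes "0 \<le> q" "q \<le> p"
  shows "p ^ n - q ^ n \<le> real n * p ^ (n - 1) * (p - q)"
proof (induction n)
  case (Suc n)
  have "p ^ Suc n - q ^ Suc n = p * (p ^ n - q ^ n) + q ^ n * (p - q)"
    by (simp add: algebra_simps)
  also have "\<dots> \<le> p * (real n * p ^ (n - 1) * (p - q)) + p ^ n * (p - q)"
    using assms Suc.IH by (intro add_mono mult_left_mono mult_right_mono power_mono) auto
  also have "\<dots> = real (Suc n) * p ^ (Suc n - 1) * (p - q)"
    by (cases n) (auto simp: algebra_simps)
  finally show ?case .
qed simp

text \<open>Double counting: the balls of radius \<open>r\<close> about the points of \<open>F\<close> lie in \<open>S\<close> and cover no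
  point more than \<open>D\<close> times.\<close>

lemma card_times_ball_le:
  fixes F S :: "'a::euclidean_space set"
  assumes F: "finite F" and D: "\<And>x. real (card (F \<inter> ball x r)) \<le> D"
    and S: "S \<in> sets borel" "\<And>x. x \<in> F \<Longrightarrow> ball x r \<subseteq> S"
  shows "of_nat (card F) * emeasure lborel (ball (0::'a) r) \<le> ennreal D * emeasure lborel S"
proof -
  have ball_eq: "emeasure lborel (ball x r) = emeasure lborel (ball (0::'a) r)" for x :: 'a
  proof -
    have "emeasure lebesgue (ball x r) = emeasure lebesgue (ball (0::'a) r)"
      using emeasure_lebesgue_affine[of 1 x "ball 0 r"] ball_translation[of x 0 r] by (simp add: add.commute)
    then show ?thesis by simp
  qed
  have "(\<Sum>x\<in>F. emeasure lborel (ball x r)) = (\<Sum>x\<in>F. emeasure lborel (ball (0::'a) r))"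
    by (intro sum.cong refl ball_eq)
  then have "of_nat (card F) * emeasure lborel (ball (0::'a) r) = (\<Sum>x\<in>F. emeasure lborel (ball x r))"
    by simp
  also have "\<dots> = (\<Sum>x\<in>F. \<integral>\<^sup>+y. indicator (ball x r) y \<partial>lborel)"
    by simp
  also have "\<dots> = (\<integral>\<^sup>+y. (\<Sum>x\<in>F. indicator (ball x r) y) \<partial>lborel)"
    by (intro nn_integral_sum[symmetric] borel_measurable_indicator) (auto intro: borel_open)
  also have "\<dots> \<le> (\<integral>\<^sup>+y. ennreal D * indicator S y \<partial>lborel)"
  proof (rule nn_integral_mono)
    fix y
    have "(\<Sum>x\<in>F. indicator (ball x r) y :: ennreal) = of_nat (card (F \<inter> ball y r))"
      using F by (simp add: indicator_def sum.If_cases Int_def dist_commute)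
    also have "\<dots> \<le> ennreal D * indicator S y"
    proof (cases "y \<in> S")
      case True
      then show ?thesis using D[of y] by (simp add: ennreal_of_nat_eq_real_of_nat ennreal_leI)
    next
      case False
      hence "F \<inter> ball y r = {}" using S(2) by (auto simp: dist_commute subset_iff)
      then show ?thesis by simp
    qed
    finally show "(\<Sum>x\<in>F. indicator (ball x r) y) \<le> ennreal D * indicator S y" .
  qed
  also have "\<dots> = ennreal D * emeasure lborel S"
    using S by (simp add: nn_integral_cmult_indicator)
  finally show ?thesis .
qed

text \<open>Points \<open>x\<close> of \<open>R K\<close> which a translation by \<open>- \<eta>\<close> moves out of \<open>R K\<close> lie within \<open>norm \<eta> / e\<close> of
  the boundary when distance is measured by dilation of \<open>K\<close>. Together with the balls of radius \<open>r\<close>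
  about them they stay in the shell between the dilates by \<open>R - r / e - norm \<eta> / e\<close> and \<open>R + r / e\<close>,
  whose volume is of order \<open>(1 + norm \<eta>) * R ^ (d - 1)\<close>.\<close>

lemma card_leaving_dilate:
  fixes K :: "'a::euclidean_space set"
  assumes K: "compact K" "convex K" and e: "e > 0" "cball 0 e \<subseteq> K" and r: "r > 0"
    and F: "finite F" and D: "\<And>x. real (card (F \<inter> ball x r)) \<le> D"
    and R: "R \<ge> 1" and inside: "F \<subseteq> dilate R K" and outside: "\<And>x. x \<in> F \<Longrightarrow> x - \<eta> \<notin> dilate R K"
  shows "real (card F) \<le> D * measure lebesgue K * real DIM('a) * (1 + r / e) ^ (DIM('a) - 1)
      * ((1 + 2 * r) / e) / measure lebesgue (ball (0::'a) r) * R ^ (DIM('a) - 1) * (1 + norm \<eta>)"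
proof -
  define d where "d = DIM('a)"
  define a u where "a = r / e" and "u = norm \<eta> / e"
  \<comment> \<open>The inner dilate is absent when the shell is thicker than \<open>R K\<close> itself.\<close>
  define q where "q = max 0 (R - a - u)"
  define Q where "Q = (if R - a - u \<ge> 0 then dilate (R - a - u) K else {})"
  define b where "b = measure lebesgue (ball (0::'a) r)"
  have b: "b > 0" unfolding b_def using r content_ball_pos[of r 0] by simp
  have a: "a > 0" and u: "u \<ge> 0" using r e by (auto simp: a_def u_def)
  have K0: "0 \<in> K" using e by auto
  have D0: "D \<ge> 0" using D[of 0] by (meson of_nat_0_le_iff order_trans)
  have near: "y \<in> dilate (t + a) K" if "x \<in> dilate t K" "y \<in> ball x r" "t \<ge> 0" for x y t
  proof -
    have "y - x \<in> dilate a K"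
      using that(2) e by (intro cball_subset_dilate[OF e]) (simp add: a_def dist_norm norm_minus_commute)
    from dilate_add[OF K(2) that(3) _ that(1) this] a have "x + (y - x) \<in> dilate (t + a) K"
      by simp
    then show ?thesis by simp
  qed
  have sub: "ball x r \<subseteq> dilate (R + a) K - Q" if x: "x \<in> F" for x
  proof
    fix y assume y: "y \<in> ball x r"
    have "y \<in> dilate (R + a) K" using near[of x R y] x inside y R by auto
    moreover have "y \<notin> Q"
    proof
      assume "y \<in> Q"
      hence yQ: "y \<in> dilate (R - a - u) K" "R - a - u \<ge> 0" by (auto simp: Q_def split: if_splits)
      have "x \<in> dilate (R - a - u + a) K"
        using y by (intro near[OF yQ(1)] yQ) (auto simp: dist_commute)
      moreover have "- \<eta> \<in> dilate u K"
        using e by (intro cball_subset_dilate[OF e]) (simp add: u_def)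
      ultimately have "x + (- \<eta>) \<in> dilate ((R - a - u + a) + u) K"
        using yQ(2) a u by (intro dilate_add[OF K(2)]) auto
      then show False using outside[OF x] by simp
    qed
    ultimately show "y \<in> dilate (R + a) K - Q" by blast
  qed
  have Qb: "Q \<in> sets borel" using K(1) by (auto simp: Q_def intro!: borel_compact compact_scaling)
  have Qm: "emeasure lborel Q = ennreal (q ^ d * measure lebesgue K)"
    unfolding Q_def q_def d_def
    by (auto simp: emeasure_dilate[OF K(1)] max_def)
  have Qs: "Q \<subseteq> dilate (R + a) K"
    unfolding Q_def using dilate_mono[OF K(2) K0, of "R - a - u" "R + a"] a u by auto
  have "of_nat (card F) * emeasure lborel (ball (0::'a) r) \<le> ennreal D * emeasure lborel (dilate (R + a) K - Q)"
    by (intro card_times_ball_le F D sub sets.Diff Qb borel_compact compact_scaling K)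
  also have "emeasure lborel (ball (0::'a) r) = ennreal b"
    using emeasure_lborel_ball_finite[of "0::'a" r] by (simp add: b_def emeasure_eq_ennreal_measure)
  also have "emeasure lborel (dilate (R + a) K - Q) = emeasure lborel (dilate (R + a) K) - emeasure lborel Q"
    using Qs Qb Qm K(1) by (intro emeasure_Diff) (auto intro!: borel_compact compact_scaling)
  also have "\<dots> = ennreal ((R + a) ^ d * measure lebesgue K - q ^ d * measure lebesgue K)"
    unfolding Qm using a R by (subst emeasure_dilate[OF K(1)]) (auto simp: d_def q_def intro!: ennreal_minus)
  also have "of_nat (card F) * ennreal b = ennreal (real (card F) * b)"
    by (simp add: ennreal_mult' ennreal_of_nat_eq_real_of_nat)
  also have "ennreal D * ennreal ((R + a) ^ d * measure lebesgue K - q ^ d * measure lebesgue K)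
     = ennreal (D * ((R + a) ^ d * measure lebesgue K - q ^ d * measure lebesgue K))"
    using D0 by (simp add: ennreal_mult')
  finally have "real (card F) * b \<le> D * ((R + a) ^ d * measure lebesgue K - q ^ d * measure lebesgue K)"
    using a R u b D0 by (subst (asm) ennreal_le_iff)
      (auto intro!: mult_nonneg_nonneg simp: q_def left_diff_distrib[symmetric] power_mono)
  also have "\<dots> = D * measure lebesgue K * ((R + a) ^ d - q ^ d)" by (simp add: algebra_simps)
  also have "\<dots> \<le> D * measure lebesgue K * (real d * (R + a) ^ (d - 1) * ((R + a) - q))"
    using a R u D0 by (intro mult_left_mono power_diff_le) (auto simp: q_def)
  also have "\<dots> \<le> D * measure lebesgue K * (real d * (R * (1 + a)) ^ (d - 1) * ((1 + 2 * r) / e * (1 + norm \<eta>)))"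
  proof (intro mult_left_mono mult_mono power_mono)
    show "R + a \<le> R * (1 + a)" using R a by (simp add: algebra_simps)
    have "R + a - q \<le> 2 * a + u" by (auto simp: q_def)
    also have "\<dots> = (2 * r + norm \<eta>) / e" by (simp add: a_def u_def add_divide_distrib)
    also have "\<dots> \<le> ((1 + 2 * r) * (1 + norm \<eta>)) / e"
      using e r by (intro divide_right_mono) (auto simp: algebra_simps)
    finally show "R + a - q \<le> (1 + 2 * r) / e * (1 + norm \<eta>)" by simp
  qed (use a R u D0 in \<open>auto simp: q_def\<close>)
  finally have "real (card F) \<le> D * measure lebesgue K * (real d * (R * (1 + a)) ^ (d - 1) * ((1 + 2 * r) / e * (1 + norm \<eta>))) / b"
    using b by (simp only: pos_le_divide_eq)
  then show ?thesis
    unfolding b_def[symmetric] a_def[symmetric] d_def[symmetric] by (simp add: power_mult_distrib mult_ac)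
qed

section \<open>Counting points with a frame-type kernel sum\<close>

text \<open>Invariance under the substitution \<open>x \<mapsto> l - x\<close>, which exchanges the variables \<open>\<xi>\<close> and
  \<open>\<eta> = l - \<xi>\<close>.\<close>

lemma nn_integral_reflect_translate:
  fixes f :: "'a::euclidean_space \<Rightarrow> ennreal"
  assumes [measurable]: "f \<in> borel_measurable borel"
  shows "(\<integral>\<^sup>+x. f (l - x) \<partial>lborel) = (\<integral>\<^sup>+x. f x \<partial>lborel)"
proof -
  have "(lborel :: 'a measure) = distr lborel borel (\<lambda>x. l - x)"
    using lborel_affine[of "-1" l] by (simp add: density_1)
  then have "(\<integral>\<^sup>+x. f x \<partial>lborel) = (\<integral>\<^sup>+x. f x \<partial>distr lborel borel (\<lambda>x. l - x))"
    by (rule arg_cong)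
  then show ?thesis by (simp add: nn_integral_distr)
qed

lemma infsum_le_nn_integral_count_space:
  fixes f :: "'b \<Rightarrow> ennreal"
  shows "(\<Sum>\<^sub>\<infinity>l\<in>\<Lambda>. f l) \<le> (\<integral>\<^sup>+l. f l \<partial>count_space \<Lambda>)"
  unfolding infsum_ennreal_eq_SUP
proof (rule SUP_least)
  fix F assume F: "F \<in> {F. finite F \<and> F \<subseteq> \<Lambda>}"
  have "sum f F = (\<integral>\<^sup>+l. f l * indicator F l \<partial>count_space \<Lambda>)"
    using F by (subst nn_integral_count_space'[of F]) auto
  also have "\<dots> \<le> (\<integral>\<^sup>+l. f l \<partial>count_space \<Lambda>)"
    by (intro nn_integral_mono) (auto split: split_indicator)
  finally show "sum f F \<le> (\<integral>\<^sup>+l. f l \<partial>count_space \<Lambda>)" .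
qed

text \<open>Centre the kernel at \<open>x\<close>: every frequency in the ball about \<open>x\<close> contributes at least \<open>c\<close> to a sum
  bounded by \<open>B\<close>. This provides the local finiteness of the frequencies.\<close>

lemma local_count_of_kernel_sum:
  fixes \<psi> :: "'a::euclidean_space \<Rightarrow> real"
  assumes low: "c > 0" "\<And>\<eta>. \<eta> \<in> ball 0 r \<Longrightarrow> c \<le> \<psi> \<eta>" and nn: "\<And>\<eta>. 0 \<le> \<psi> \<eta>"
    and up: "\<And>\<xi>. (\<Sum>\<^sub>\<infinity>l\<in>\<Lambda>. ennreal (\<psi> (l - \<xi>))) \<le> ennreal B" and B: "B \<ge> 0"
  shows "finite (\<Lambda> \<inter> ball x r)" and "real (card (\<Lambda> \<inter> ball x r)) \<le> B / c"
proof -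
  have fin: "real (card F) \<le> B / c" if F: "finite F" "F \<subseteq> \<Lambda> \<inter> ball x r" for F
  proof -
    have "ennreal (real (card F) * c) = ennreal (\<Sum>l\<in>F. c)" by simp
    also have "\<dots> \<le> ennreal (\<Sum>l\<in>F. \<psi> (l - x))"
      using F(2) by (intro ennreal_leI sum_mono low) (auto simp: dist_norm norm_minus_commute)
    also have "\<dots> = (\<Sum>l\<in>F. ennreal (\<psi> (l - x)))"
      by (rule sum_ennreal[symmetric]) (rule nn)
    also have "\<dots> \<le> (\<Sum>\<^sub>\<infinity>l\<in>\<Lambda>. ennreal (\<psi> (l - x)))"
      unfolding infsum_ennreal_eq_SUP using F by (intro SUP_upper) auto
    also have "\<dots> \<le> ennreal B" by (rule up)
    finally show ?thesis using low(1) B by (simp add: ennreal_le_iff pos_le_divide_eq)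
  qed
  show f: "finite (\<Lambda> \<inter> ball x r)"
  proof (rule ccontr)
    assume "infinite (\<Lambda> \<inter> ball x r)"
    then obtain F where F: "finite F" "card F = nat \<lceil>B / c\<rceil> + 1" "F \<subseteq> \<Lambda> \<inter> ball x r"
      using infinite_arbitrarily_large by blast
    then show False using fin[OF F(1,3)] by linarith
  qed
  show "real (card (\<Lambda> \<inter> ball x r)) \<le> B / c" by (rule fin[OF f]) simp
qed

lemma finite_Int_bounded:
  fixes \<Lambda> :: "'a::euclidean_space set"
  assumes "r > 0" "\<And>x. finite (\<Lambda> \<inter> ball x r)" "bounded S"
  shows "finite (\<Lambda> \<inter> S)"
proof -
  have "compact (closure S)" using assms(3) by simp
  moreover have "closure S \<subseteq> (\<Union>x\<in>UNIV. ball x r)" using assms(1) centre_in_ball by blast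
  ultimately obtain X where X: "finite X" "closure S \<subseteq> (\<Union>x\<in>X. ball x r)"
    by (rule compactE_image[OF _ open_ball])
  have "\<Lambda> \<inter> S \<subseteq> (\<Union>x\<in>X. \<Lambda> \<inter> ball x r)" using X(2) closure_subset[of S] by blast
  moreover have "finite (\<Union>x\<in>X. \<Lambda> \<inter> ball x r)" using X(1) assms(2) by (intro finite_UN_I)
  ultimately show ?thesis by (rule finite_subset)
qed

lemma countable_locally_finite:
  fixes \<Lambda> :: "'a::euclidean_space set"
  assumes "r > 0" "\<And>x. finite (\<Lambda> \<inter> ball x r)"
  shows "countable \<Lambda>"
proof -
  have "\<Lambda> \<subseteq> (\<Union>n::nat. \<Lambda> \<inter> ball 0 (real n))"
  proof
    fix x assume "x \<in> \<Lambda>"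
    moreover obtain n where "norm x < real n" using reals_Archimedean2 by blast
    ultimately show "x \<in> (\<Union>n::nat. \<Lambda> \<inter> ball 0 (real n))" by (intro UN_I[of n]) auto
  qed
  moreover have "countable (\<Lambda> \<inter> ball 0 (real n))" for n
    by (intro countable_finite finite_Int_bounded[OF assms] bounded_ball)
  hence "countable (\<Union>n::nat. \<Lambda> \<inter> ball 0 (real n))" by (intro countable_UN) auto
  ultimately show ?thesis by (rule countable_subset)
qed

text \<open>Integrate the bounds on the sum of \<open>\<psi> (l - \<xi>)\<close> over \<open>\<xi>\<close> in \<open>S = dilate R K\<close>. Up to the pairs
  \<open>(l, \<xi>)\<close> with exactly one entry in \<open>S\<close>, the result is \<open>G\<close> times the number of \<open>l\<close> in \<open>S\<close>. In the
  integral over the exceptional pairs substitute \<open>\<eta> = l - \<xi>\<close> and sum over \<open>l\<close> first: for fixed \<open>\<eta>\<close>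
  the points \<open>l\<close> are counted by \<open>card_leaving_dilate\<close>, applied either to \<open>l\<close> or to \<open>l - \<eta>\<close>, and
  the remaining integral over \<open>\<eta>\<close> is at most a constant times the first moment \<open>M\<close>. For the
  upper bound only pairs with \<open>l\<close> in \<open>S\<close> matter, for the lower bound only those with \<open>\<xi>\<close> in
  \<open>S\<close>.\<close>

lemma kernel_sum_counting:
  fixes K :: "'a::euclidean_space set" and \<psi> :: "'a \<Rightarrow> real"
  assumes K: "compact K" "convex K" and e: "e > 0" "cball 0 e \<subseteq> K"
    and \<psi>[measurable]: "\<psi> \<in> borel_measurable borel" and nn: "\<And>\<eta>. 0 \<le> \<psi> \<eta>"
    and G: "(\<integral>\<^sup>+\<eta>. ennreal (\<psi> \<eta>) \<partial>lborel) = ennreal G" "G \<ge> 0"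
    and M: "(\<integral>\<^sup>+\<eta>. ennreal (\<psi> \<eta> * (1 + norm \<eta>)) \<partial>lborel) = ennreal M" "M \<ge> 0"
    and r: "r > 0" and fin: "\<And>x. finite (\<Lambda> \<inter> ball x r)" and D: "\<And>x. real (card (\<Lambda> \<inter> ball x r)) \<le> D"
    and R: "R \<ge> 1"
  defines "C \<equiv> D * measure lebesgue K * real DIM('a) * (1 + r / e) ^ (DIM('a) - 1)
      * ((1 + 2 * r) / e) / measure lebesgue (ball (0::'a) r)"
  shows kernel_sum_counting_upper:
     "\<lbrakk>\<And>\<xi>. (\<Sum>\<^sub>\<infinity>l\<in>\<Lambda>. ennreal (\<psi> (l - \<xi>))) \<le> ennreal B; B \<ge> 0\<rbrakk> \<Longrightarrow>
       real (card (\<Lambda> \<inter> dilate R K)) * G \<le> B * measure lebesgue K * R ^ DIM('a) + C * M * R ^ (DIM('a) - 1)" 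
    and kernel_sum_counting_lower:
     "\<lbrakk>\<And>\<xi>. ennreal A \<le> (\<Sum>\<^sub>\<infinity>l\<in>\<Lambda>. ennreal (\<psi> (l - \<xi>))); A \<ge> 0\<rbrakk> \<Longrightarrow>
       A * measure lebesgue K * R ^ DIM('a) \<le> real (card (\<Lambda> \<inter> dilate R K)) * G + C * M * R ^ (DIM('a) - 1)"
proof -
  define S where "S = dilate R K"
  define d where "d = DIM('a)"
  define N where "N = card (\<Lambda> \<inter> S)"
  have Sc: "compact S" unfolding S_def using K(1) by (rule compact_scaling)
  have Sb[measurable]: "S \<in> sets borel" using Sc by (rule borel_compact)
  have finS: "finite (\<Lambda> \<inter> S)"
    by (intro finite_Int_bounded[OF r fin] compact_imp_bounded Sc)
  have count: "countable \<Lambda>" by (rule countable_locally_finite[OF r fin])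
  have D0: "D \<ge> 0" using D[of 0] by (meson of_nat_0_le_iff order_trans)
  have C0: "C \<ge> 0" unfolding C_def using D0 e r
    by (intro divide_nonneg_nonneg mult_nonneg_nonneg) auto
  have Sm: "emeasure lborel S = ennreal (R ^ d * measure lebesgue K)"
    unfolding S_def d_def using emeasure_dilate[OF K(1)] R by simp
  have leave: "real (card F) \<le> C * R ^ (d - 1) * (1 + norm \<eta>)"
    if "finite F" "\<And>x. real (card (F \<inter> ball x r)) \<le> D" "F \<subseteq> S" "\<And>x. x \<in> F \<Longrightarrow> x - \<eta> \<notin> S" for F \<eta>
    unfolding C_def d_def using card_leaving_dilate[OF K e r that(1,2) R] that(3,4) unfolding S_def by blast
  have count1: "of_nat (card {l \<in> \<Lambda>. l \<in> S \<and> l - \<eta> \<notin> S}) \<le> ennreal (C * R ^ (d - 1) * (1 + norm \<eta>))" for \<eta>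
  proof -
    have "real (card {l \<in> \<Lambda>. l \<in> S \<and> l - \<eta> \<notin> S}) \<le> C * R ^ (d - 1) * (1 + norm \<eta>)"
    proof (rule leave)
      show "finite {l \<in> \<Lambda>. l \<in> S \<and> l - \<eta> \<notin> S}" using finS by (rule rev_finite_subset) auto
      have "card ({l \<in> \<Lambda>. l \<in> S \<and> l - \<eta> \<notin> S} \<inter> ball x r) \<le> card (\<Lambda> \<inter> ball x r)" for x
        by (rule card_mono[OF fin]) auto
      then show "real (card ({l \<in> \<Lambda>. l \<in> S \<and> l - \<eta> \<notin> S} \<inter> ball x r)) \<le> D" for x
        using D[of x] by (meson of_nat_mono order_trans)
    qed auto
    then show ?thesis by (simp add: ennreal_of_nat_eq_real_of_nat ennreal_leI)
  qed
  have fin2: "finite {l \<in> \<Lambda>. l \<notin> S \<and> l - \<eta> \<in> S}" for \<eta>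
  proof -
    have "finite (\<Lambda> \<inter> (+) \<eta> ` S)"
      by (intro finite_Int_bounded[OF r fin] bounded_translation compact_imp_bounded Sc)
    then show ?thesis by (rule rev_finite_subset) (auto intro: image_eqI[of _ _ "_ - \<eta>"])
  qed
  have count2: "of_nat (card {l \<in> \<Lambda>. l \<notin> S \<and> l - \<eta> \<in> S}) \<le> ennreal (C * R ^ (d - 1) * (1 + norm \<eta>))" for \<eta>
  proof -
    define F where "F = {l \<in> \<Lambda>. l \<notin> S \<and> l - \<eta> \<in> S}"
    define T where "T = (\<lambda>l. l - \<eta>)"
    have inj: "inj_on T X" for X by (auto simp: T_def inj_on_def)
    have "real (card (T ` F)) \<le> C * R ^ (d - 1) * (1 + norm (- \<eta>))"
    proof (rule leave)
      show "finite (T ` F)" using fin2 unfolding F_def by (rule finite_imageI)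
      show "T ` F \<subseteq> S" by (auto simp: T_def F_def)
      show "x - - \<eta> \<notin> S" if "x \<in> T ` F" for x using that by (auto simp: T_def F_def)
      fix x
      have "T ` F \<inter> ball x r \<subseteq> T ` (\<Lambda> \<inter> ball (x + \<eta>) r)"
        by (auto simp: T_def F_def dist_norm algebra_simps)
      then have "card (T ` F \<inter> ball x r) \<le> card (T ` (\<Lambda> \<inter> ball (x + \<eta>) r))"
        using fin by (intro card_mono finite_imageI)
      also have "\<dots> = card (\<Lambda> \<inter> ball (x + \<eta>) r)" by (rule card_image[OF inj])
      finally show "real (card (T ` F \<inter> ball x r)) \<le> D" using D[of "x + \<eta>"] by linarith
    qed
    then show ?thesis
      by (simp add: card_image[OF inj] F_def[symmetric] ennreal_of_nat_eq_real_of_nat ennreal_leI)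
  qed
  have err: "(\<integral>\<^sup>+\<eta>. ennreal (\<psi> \<eta>) * of_nat (k \<eta>) \<partial>lborel) \<le> ennreal (C * M * R ^ (d - 1))"
    if k: "\<And>\<eta>. of_nat (k \<eta>) \<le> ennreal (C * R ^ (d - 1) * (1 + norm \<eta>))" for k :: "'a \<Rightarrow> nat"
  proof -
    have "(\<integral>\<^sup>+\<eta>. ennreal (\<psi> \<eta>) * of_nat (k \<eta>) \<partial>lborel)
       \<le> (\<integral>\<^sup>+\<eta>. ennreal (C * R ^ (d - 1)) * ennreal (\<psi> \<eta> * (1 + norm \<eta>)) \<partial>lborel)"
    proof (rule nn_integral_mono)
      fix \<eta> :: 'a
      have "ennreal (\<psi> \<eta>) * of_nat (k \<eta>) \<le> ennreal (\<psi> \<eta>) * ennreal (C * R ^ (d - 1) * (1 + norm \<eta>))"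
        by (intro mult_left_mono k) auto
      also have "\<dots> = ennreal (C * R ^ (d - 1)) * ennreal (\<psi> \<eta> * (1 + norm \<eta>))"
        using nn[of \<eta>] C0 R by (simp add: ennreal_mult[symmetric] mult_ac)
      finally show "ennreal (\<psi> \<eta>) * of_nat (k \<eta>) \<le> ennreal (C * R ^ (d - 1)) * ennreal (\<psi> \<eta> * (1 + norm \<eta>))" .
    qed
    also have "\<dots> = ennreal (C * R ^ (d - 1)) * ennreal M"
      unfolding M(1)[symmetric] by (intro nn_integral_cmult) measurable
    also have "\<dots> = ennreal (C * M * R ^ (d - 1))"
      using M(2) C0 R by (simp add: ennreal_mult[symmetric] mult_ac)
    finally show ?thesis .
  qed
  have swap: "(\<integral>\<^sup>+l. \<integral>\<^sup>+\<xi>. ennreal (\<psi> (l - \<xi>)) * (indicator P l * indicator Q \<xi>) \<partial>lborel \<partial>count_space \<Lambda>)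
     = (\<integral>\<^sup>+\<eta>. ennreal (\<psi> \<eta>) * of_nat (card {l \<in> \<Lambda>. l \<in> P \<and> l - \<eta> \<in> Q}) \<partial>lborel)"
    if Q[measurable]: "Q \<in> sets borel" and f: "\<And>\<eta>. finite {l \<in> \<Lambda>. l \<in> P \<and> l - \<eta> \<in> Q}" for P Q
  proof -
    have "(\<integral>\<^sup>+\<xi>. ennreal (\<psi> (l - \<xi>)) * (indicator P l * indicator Q \<xi>) \<partial>lborel)
       = (\<integral>\<^sup>+\<eta>. ennreal (\<psi> \<eta>) * (indicator P l * indicator Q (l - \<eta>)) \<partial>lborel)" for l
      using nn_integral_reflect_translate[of "\<lambda>\<eta>. ennreal (\<psi> \<eta>) * (indicator P l * indicator Q (l - \<eta>))" l]
      by simp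
    then have "(\<integral>\<^sup>+l. \<integral>\<^sup>+\<xi>. ennreal (\<psi> (l - \<xi>)) * (indicator P l * indicator Q \<xi>) \<partial>lborel \<partial>count_space \<Lambda>)
      = (\<integral>\<^sup>+l. \<integral>\<^sup>+\<eta>. ennreal (\<psi> \<eta>) * (indicator P l * indicator Q (l - \<eta>)) \<partial>lborel \<partial>count_space \<Lambda>)"
      by simp
    also have "\<dots> = (\<integral>\<^sup>+\<eta>. \<integral>\<^sup>+l. ennreal (\<psi> \<eta>) * (indicator P l * indicator Q (l - \<eta>)) \<partial>count_space \<Lambda> \<partial>lborel)"
      by (intro nn_integral_count_space_nn_integral[symmetric] count) measurable
    also have "\<dots> = (\<integral>\<^sup>+\<eta>. ennreal (\<psi> \<eta>) * of_nat (card {l \<in> \<Lambda>. l \<in> P \<and> l - \<eta> \<in> Q}) \<partial>lborel)"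
    proof (rule nn_integral_cong)
      fix \<eta>
      have "(\<integral>\<^sup>+l. ennreal (\<psi> \<eta>) * (indicator P l * indicator Q (l - \<eta>)) \<partial>count_space \<Lambda>)
         = (\<Sum>l\<in>{l \<in> \<Lambda>. l \<in> P \<and> l - \<eta> \<in> Q}. ennreal (\<psi> \<eta>) * (indicator P l * indicator Q (l - \<eta>)))"
        by (rule nn_integral_count_space'[OF f]) (auto split: split_indicator)
      also have "\<dots> = (\<Sum>l\<in>{l \<in> \<Lambda>. l \<in> P \<and> l - \<eta> \<in> Q}. ennreal (\<psi> \<eta>))"
        by (intro sum.cong) auto
      finally show "(\<integral>\<^sup>+l. ennreal (\<psi> \<eta>) * (indicator P l * indicator Q (l - \<eta>)) \<partial>count_space \<Lambda>)
         = ennreal (\<psi> \<eta>) * of_nat (card {l \<in> \<Lambda>. l \<in> P \<and> l - \<eta> \<in> Q})"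
        by (simp add: mult.commute)
    qed
    finally show ?thesis .
  qed
  have tot: "(\<integral>\<^sup>+\<xi>. ennreal (\<psi> (l - \<xi>)) \<partial>lborel) = ennreal G" for l
    using nn_integral_reflect_translate[of "\<lambda>\<eta>. ennreal (\<psi> \<eta>)" l] G(1) by simp
  have Nsum: "(\<integral>\<^sup>+l. \<integral>\<^sup>+\<xi>. ennreal (\<psi> (l - \<xi>)) * indicator S l \<partial>lborel \<partial>count_space \<Lambda>) = ennreal (real N * G)"
  proof -
    have "(\<integral>\<^sup>+l. \<integral>\<^sup>+\<xi>. ennreal (\<psi> (l - \<xi>)) * indicator S l \<partial>lborel \<partial>count_space \<Lambda>)
       = (\<integral>\<^sup>+l. ennreal G * indicator S l \<partial>count_space \<Lambda>)"
      by (intro nn_integral_cong, subst nn_integral_multc) (auto simp: tot)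
    also have "\<dots> = (\<Sum>l\<in>\<Lambda> \<inter> S. ennreal G * indicator S l)"
      by (rule nn_integral_count_space'[OF finS]) auto
    also have "\<dots> = (\<Sum>l\<in>\<Lambda> \<inter> S. ennreal G)" by (intro sum.cong) auto
    also have "\<dots> = ennreal (real N * G)"
      by (simp add: N_def ennreal_mult' ennreal_of_nat_eq_real_of_nat G(2))
    finally show ?thesis .
  qed
  show "real (card (\<Lambda> \<inter> dilate R K)) * G \<le> B * measure lebesgue K * R ^ DIM('a) + C * M * R ^ (DIM('a) - 1)"
    if up: "\<And>\<xi>. (\<Sum>\<^sub>\<infinity>l\<in>\<Lambda>. ennreal (\<psi> (l - \<xi>))) \<le> ennreal B" and B: "B \<ge> 0"
  proof -
    have "(\<integral>\<^sup>+l. \<integral>\<^sup>+\<xi>. ennreal (\<psi> (l - \<xi>)) * (indicator S l * indicator S \<xi>) \<partial>lborel \<partial>count_space \<Lambda>)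
        = (\<Sum>l\<in>\<Lambda> \<inter> S. \<integral>\<^sup>+\<xi>. ennreal (\<psi> (l - \<xi>)) * (indicator S l * indicator S \<xi>) \<partial>lborel)"
      by (rule nn_integral_count_space'[OF finS]) auto
    also have "\<dots> = (\<integral>\<^sup>+\<xi>. (\<Sum>l\<in>\<Lambda> \<inter> S. ennreal (\<psi> (l - \<xi>)) * (indicator S l * indicator S \<xi>)) \<partial>lborel)"
      by (intro nn_integral_sum[symmetric]) measurable
    also have "\<dots> \<le> (\<integral>\<^sup>+\<xi>. ennreal B * indicator S \<xi> \<partial>lborel)"
    proof (rule nn_integral_mono)
      fix \<xi>
      have "(\<Sum>l\<in>\<Lambda> \<inter> S. ennreal (\<psi> (l - \<xi>)) * (indicator S l * indicator S \<xi>)) = (\<Sum>l\<in>\<Lambda> \<inter> S. ennreal (\<psi> (l - \<xi>))) * indicator S \<xi>"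
        unfolding sum_distrib_right by (intro sum.cong) auto
      also have "\<dots> \<le> ennreal B * indicator S \<xi>"
      proof (intro mult_right_mono order.trans[OF _ up[of \<xi>]])
        show "(\<Sum>l\<in>\<Lambda> \<inter> S. ennreal (\<psi> (l - \<xi>))) \<le> (\<Sum>\<^sub>\<infinity>l\<in>\<Lambda>. ennreal (\<psi> (l - \<xi>)))"
          unfolding infsum_ennreal_eq_SUP using finS by (intro SUP_upper) auto
      qed auto
      finally show "(\<Sum>l\<in>\<Lambda> \<inter> S. ennreal (\<psi> (l - \<xi>)) * (indicator S l * indicator S \<xi>)) \<le> ennreal B * indicator S \<xi>" .
    qed
    also have "\<dots> = ennreal (B * (R ^ d * measure lebesgue K))"
      using B R Sm by (simp add: nn_integral_cmult_indicator ennreal_mult)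
    finally have I: "(\<integral>\<^sup>+l. \<integral>\<^sup>+\<xi>. ennreal (\<psi> (l - \<xi>)) * (indicator S l * indicator S \<xi>) \<partial>lborel \<partial>count_space \<Lambda>)
        \<le> ennreal (B * (R ^ d * measure lebesgue K))" .
    have II: "(\<integral>\<^sup>+l. \<integral>\<^sup>+\<xi>. ennreal (\<psi> (l - \<xi>)) * (indicator S l * indicator (- S) \<xi>) \<partial>lborel \<partial>count_space \<Lambda>)
        \<le> ennreal (C * M * R ^ (d - 1))"
    proof -
      have "finite {l \<in> \<Lambda>. l \<in> S \<and> l - \<eta> \<in> - S}" for \<eta>
        using finS by (rule rev_finite_subset) auto
      from swap[OF _ this] show ?thesis using err[OF count1] Sb by (simp only: Compl_iff sets.compl_sets borel_comp)
    qed
    have "ennreal (real N * G) = (\<integral>\<^sup>+l. (\<integral>\<^sup>+\<xi>. ennreal (\<psi> (l - \<xi>)) * (indicator S l * indicator S \<xi>) \<partial>lborel)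
         + (\<integral>\<^sup>+\<xi>. ennreal (\<psi> (l - \<xi>)) * (indicator S l * indicator (- S) \<xi>) \<partial>lborel) \<partial>count_space \<Lambda>)"
      unfolding Nsum[symmetric]
      by (intro nn_integral_cong, subst nn_integral_add[symmetric])
         (auto intro!: nn_integral_cong split: split_indicator)
    also have "\<dots> \<le> ennreal (B * (R ^ d * measure lebesgue K)) + ennreal (C * M * R ^ (d - 1))"
      by (subst nn_integral_add, simp, simp, rule add_mono[OF I II])
    also have "\<dots> = ennreal (B * (R ^ d * measure lebesgue K) + C * M * R ^ (d - 1))"
      using B R C0 M(2) by (intro ennreal_plus[symmetric]) auto
    finally have "real N * G \<le> B * (R ^ d * measure lebesgue K) + C * M * R ^ (d - 1)"
      using B R C0 M(2) by (subst (asm) ennreal_le_iff) auto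
    then show ?thesis unfolding N_def S_def d_def by (simp add: mult_ac)
  qed
  show "A * measure lebesgue K * R ^ DIM('a) \<le> real (card (\<Lambda> \<inter> dilate R K)) * G + C * M * R ^ (DIM('a) - 1)"
    if low: "\<And>\<xi>. ennreal A \<le> (\<Sum>\<^sub>\<infinity>l\<in>\<Lambda>. ennreal (\<psi> (l - \<xi>)))" and A: "A \<ge> 0"
  proof -
    have II: "(\<integral>\<^sup>+l. \<integral>\<^sup>+\<xi>. ennreal (\<psi> (l - \<xi>)) * (indicator (- S) l * indicator S \<xi>) \<partial>lborel \<partial>count_space \<Lambda>)
        \<le> ennreal (C * M * R ^ (d - 1))"
    proof -
      have "finite {l \<in> \<Lambda>. l \<in> - S \<and> l - \<eta> \<in> S}" for \<eta> using fin2[of \<eta>] by simp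
      from swap[OF Sb this] show ?thesis using err[OF count2] by (simp only: Compl_iff)
    qed
    have "ennreal (A * (R ^ d * measure lebesgue K)) = (\<integral>\<^sup>+\<xi>. ennreal A * indicator S \<xi> \<partial>lborel)"
      using A R Sm by (simp add: nn_integral_cmult_indicator ennreal_mult)
    also have "\<dots> \<le> (\<integral>\<^sup>+\<xi>. \<integral>\<^sup>+l. ennreal (\<psi> (l - \<xi>)) * indicator S \<xi> \<partial>count_space \<Lambda> \<partial>lborel)"
    proof (rule nn_integral_mono)
      fix \<xi>
      have "ennreal A \<le> (\<integral>\<^sup>+l. ennreal (\<psi> (l - \<xi>)) \<partial>count_space \<Lambda>)"
        using low[of \<xi>] infsum_le_nn_integral_count_space by (rule order.trans)
      then show "ennreal A * indicator S \<xi> \<le> (\<integral>\<^sup>+l. ennreal (\<psi> (l - \<xi>)) * indicator S \<xi> \<partial>count_space \<Lambda>)"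
        by (auto split: split_indicator)
    qed
    also have "\<dots> = (\<integral>\<^sup>+l. \<integral>\<^sup>+\<xi>. ennreal (\<psi> (l - \<xi>)) * indicator S \<xi> \<partial>lborel \<partial>count_space \<Lambda>)"
      by (intro nn_integral_count_space_nn_integral count) measurable
    also have "\<dots> \<le> (\<integral>\<^sup>+l. (\<integral>\<^sup>+\<xi>. ennreal (\<psi> (l - \<xi>)) * indicator S l \<partial>lborel)
         + (\<integral>\<^sup>+\<xi>. ennreal (\<psi> (l - \<xi>)) * (indicator (- S) l * indicator S \<xi>) \<partial>lborel) \<partial>count_space \<Lambda>)"
      by (intro nn_integral_mono, subst nn_integral_add[symmetric])
         (auto intro!: nn_integral_mono split: split_indicator)
    also have "\<dots> \<le> ennreal (real N * G) + ennreal (C * M * R ^ (d - 1))"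
      by (subst nn_integral_add, simp, simp, rule add_mono[OF eq_refl[OF Nsum] II])
    also have "\<dots> = ennreal (real N * G + C * M * R ^ (d - 1))"
      using R C0 M(2) G(2) by (intro ennreal_plus[symmetric]) auto
    finally have "A * (R ^ d * measure lebesgue K) \<le> real N * G + C * M * R ^ (d - 1)"
      using R C0 M(2) G(2) by (subst (asm) ennreal_le_iff) auto
    then show ?thesis unfolding N_def S_def d_def by (simp add: mult_ac)
  qed
qed

section \<open>Frontiers have Minkowski dimension at least the dimension minus one\<close>

text \<open>Let \<open>W\<close> be the set of points of \<open>\<Omega>\<close> which leave \<open>\<Omega>\<close> when they move by \<open>h\<close> in a fixed direction
  \<open>b\<close>. Each point of \<open>\<Omega>\<close> leaves \<open>\<Omega>\<close> after \<open>O(1 / h)\<close> such moves, and just before it does so it is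
  in \<open>W\<close>. Hence \<open>O(1 / h)\<close> translates of \<open>W\<close> cover \<open>\<Omega>\<close>, and the measure of \<open>W\<close> is at least a multiple
  of \<open>h\<close>. On the other hand the segment from a point of \<open>W\<close> to its translate meets the frontier,
  so \<open>W\<close> lies in the thickened frontier.\<close>

lemma emeasure_frontier_thickening_ge:
  fixes \<Omega> :: "'a::euclidean_space set"
  assumes \<Omega>: "open \<Omega>" "bounded \<Omega>" "measure lebesgue \<Omega> > 0"
  obtains c where "c > 0" "\<And>h. 0 < h \<Longrightarrow> h \<le> 1 \<Longrightarrow> ennreal (c * h) \<le> emeasure lebesgue {x. infdist x (frontier \<Omega>) < h}"
proof -
  define m where "m = measure lebesgue \<Omega>"
  obtain b :: 'a where b: "b \<in> Basis" using nonempty_Basis by blast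
  have nb: "norm b = 1" using b by simp
  obtain L where L: "L > 0" "\<And>x. x \<in> \<Omega> \<Longrightarrow> norm x \<le> L"
    using \<Omega>(2) unfolding bounded_pos by blast
  have m: "ennreal m = emeasure lebesgue \<Omega>"
    unfolding m_def using \<Omega> by (simp add: emeasure_eq_measure2 lmeasurable_open)
  have main: "ennreal (m / (2 * (2 * L + 1)) * (2 * h)) \<le> emeasure lebesgue {x. infdist x (frontier \<Omega>) < 2 * h}"
    if h: "0 < h" "h \<le> 1" for h
  proof -
    define W where "W = {x \<in> \<Omega>. x + h *\<^sub>R b \<notin> \<Omega>}"
    define N where "N = nat \<lfloor>2 * L / h\<rfloor> + 1"
    have N1: "2 * L / h < real N" unfolding N_def using L h by (simp add: of_nat_nat) linarith
    have N2: "real N \<le> (2 * L + 1) / h"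
    proof -
      have "real N \<le> 2 * L / h + 1" unfolding N_def using L h by (simp add: of_nat_nat)
      also have "\<dots> \<le> (2 * L + 1) / h" using h by (simp add: field_simps)
      finally show ?thesis .
    qed
    have W_eq: "W = \<Omega> - (\<lambda>x. x + h *\<^sub>R b) -` \<Omega>" by (auto simp: W_def)
    have Wm: "W \<in> sets borel" unfolding W_eq
      using \<Omega>(1) by (intro sets.Diff borel_open open_vimage continuous_intros) auto
    have cover: "\<Omega> \<subseteq> (\<Union>k\<in>{..<N}. (+) (- (real k * h) *\<^sub>R b) ` W)"
    proof
      fix x assume x: "x \<in> \<Omega>"
      define P where "P = (\<lambda>k. x + (real k * h) *\<^sub>R b \<notin> \<Omega>)"
      have PN: "P N"
        unfolding P_def
      proof
        assume "x + (real N * h) *\<^sub>R b \<in> \<Omega>"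
        hence "norm (x + (real N * h) *\<^sub>R b) \<le> L" by (rule L)
        moreover have "norm ((real N * h) *\<^sub>R b) \<le> norm (x + (real N * h) *\<^sub>R b) + norm x"
          using norm_triangle_ineq4[of "x + (real N * h) *\<^sub>R b" x] by simp
        ultimately have "real N * h \<le> 2 * L" using L(2)[OF x] h nb by simp
        then show False using N1 h by (simp add: field_simps)
      qed
      \<comment> \<open>At the last step before the first exit the point is in \<open>W\<close>.\<close>
      define j where "j = (LEAST k. P k)"
      have Pj: "P j" "j \<le> N" unfolding j_def using PN by (auto intro: LeastI Least_le)
      have "j \<noteq> 0" using Pj(1) x unfolding P_def by (cases "j = 0") auto
      then obtain k where k: "j = Suc k" by (cases j) auto
      have "\<not> P k" using not_less_Least[of k P] k by (simp add: j_def[symmetric])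
      hence "x + (real k * h) *\<^sub>R b \<in> W"
        using Pj(1) unfolding k P_def W_def by (auto simp: algebra_simps)
      moreover have "x = - (real k * h) *\<^sub>R b + (x + (real k * h) *\<^sub>R b)" by simp
      ultimately show "x \<in> (\<Union>k\<in>{..<N}. (+) (- (real k * h) *\<^sub>R b) ` W)"
        using Pj(2) k by (intro UN_I[of k] image_eqI[of x _ "x + (real k * h) *\<^sub>R b"]) simp_all
    qed
    have trans: "emeasure lebesgue ((+) v ` W) = emeasure lebesgue W" for v
      using emeasure_lebesgue_affine[of 1 v W] by (simp add: add.commute)
    have transm: "(+) v ` W \<in> sets lebesgue" for v
      using Wm by (intro lebesgue_sets_translation) auto
    have "ennreal m \<le> emeasure lebesgue (\<Union>k\<in>{..<N}. (+) (- (real k * h) *\<^sub>R b) ` W)"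
      unfolding m by (intro emeasure_mono cover sets.finite_UN transm finite_lessThan)
    also have "\<dots> \<le> (\<Sum>k<N. emeasure lebesgue ((+) (- (real k * h) *\<^sub>R b) ` W))"
      by (intro emeasure_subadditive_finite finite_lessThan image_subsetI transm)
    also have "\<dots> = of_nat N * emeasure lebesgue W" by (simp only: trans) simp
    also have "\<dots> \<le> ennreal ((2 * L + 1) / h) * emeasure lebesgue W"
      using N2 by (intro mult_right_mono) (auto simp: ennreal_of_nat_eq_real_of_nat intro: ennreal_leI)
    finally have "ennreal (h / (2 * L + 1)) * ennreal m \<le>
       ennreal (h / (2 * L + 1)) * (ennreal ((2 * L + 1) / h) * emeasure lebesgue W)"
      by (intro mult_left_mono) auto
    also have "\<dots> = emeasure lebesgue W"
      using h L by (simp add: ennreal_mult[symmetric] flip: mult.assoc)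
    also have "W \<subseteq> {x. infdist x (frontier \<Omega>) < 2 * h}"
    proof
      fix x assume x: "x \<in> W"
      have "closed_segment x (x + h *\<^sub>R b) \<inter> frontier \<Omega> \<noteq> {}"
        using x by (intro connected_Int_frontier) (auto simp: W_def)
      then obtain p where p: "p \<in> closed_segment x (x + h *\<^sub>R b)" "p \<in> frontier \<Omega>" by blast
      have "dist x p \<le> h"
        using segment_bound(1)[OF p(1)] h nb by (simp add: dist_norm norm_minus_commute)
      then have "infdist x (frontier \<Omega>) \<le> h" using infdist_le[OF p(2), of x] by simp
      then show "x \<in> {x. infdist x (frontier \<Omega>) < 2 * h}" using h by simp
    qed
    then have "emeasure lebesgue W \<le> emeasure lebesgue {x. infdist x (frontier \<Omega>) < 2 * h}"
      by (intro emeasure_mono) (auto intro!: borel_open open_Collect_less continuous_intros)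
    finally have "ennreal (h / (2 * L + 1)) * ennreal m \<le> emeasure lebesgue {x. infdist x (frontier \<Omega>) < 2 * h}" .
    moreover have "ennreal (h / (2 * L + 1) * m) = ennreal (h / (2 * L + 1)) * ennreal m"
      using L h by (intro ennreal_mult) (auto simp: m_def)
    moreover have "m / (2 * (2 * L + 1)) * (2 * h) = h / (2 * L + 1) * m"
      using L by (simp add: field_simps)
    ultimately show ?thesis by (simp only:)
  qed
  show thesis
  proof (rule that)
    show "m / (2 * (2 * L + 1)) > 0" using \<Omega>(3) L by (simp add: m_def)
    show "ennreal (m / (2 * (2 * L + 1)) * h) \<le> emeasure lebesgue {x. infdist x (frontier \<Omega>) < h}"
      if "0 < h" "h \<le> 1" for h
      using main[of "h / 2"] that by simp
  qed
qed

text \<open>The thickened frontier has measure at least \<open>c * h\<close>, and \<open>h powr (\<alpha> - d) * h\<close> is unbounded as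
  \<open>h\<close> tends to \<open>0\<close> when \<open>\<alpha> < d - 1\<close>.\<close>

lemma upper_minkowski_content_frontier_infinite:
  fixes \<Omega> :: "'a::euclidean_space set"
  assumes \<Omega>: "open \<Omega>" "bounded \<Omega>" "measure lebesgue \<Omega> > 0" and \<alpha>: "\<alpha> < real DIM('a) - 1"
  shows "upper_minkowski_content (frontier \<Omega>) \<alpha> = \<infinity>"
proof -
  define \<beta> where "\<beta> = real DIM('a) - 1 - \<alpha>"
  have \<beta>: "\<beta> > 0" using \<alpha> by (simp add: \<beta>_def)
  obtain c where c: "c > 0" "\<And>h. 0 < h \<Longrightarrow> h \<le> 1 \<Longrightarrow> ennreal (c * h) \<le> emeasure lebesgue {x. infdist x (frontier \<Omega>) < h}"
    using emeasure_frontier_thickening_ge[OF \<Omega>] by blast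
  have "ennreal C \<le> upper_minkowski_content (frontier \<Omega>) \<alpha>" for C
    unfolding upper_minkowski_content_def
  proof (rule le_Limsup)
    have "filterlim (\<lambda>h::real. c * h powr (- \<beta>)) at_top (at_right 0)"
      using \<beta> c by real_asymp
    then have "eventually (\<lambda>h. C \<le> c * h powr (- \<beta>)) (at_right (0::real))"
      by (simp add: filterlim_at_top)
    moreover have "eventually (\<lambda>h. 0 < h \<and> h \<le> 1) (at_right (0::real))"
      by (auto simp: eventually_at_right_field intro!: exI[of _ 1])
    ultimately show "\<forall>\<^sub>F h in at_right 0. ennreal C \<le> ennreal (h powr (- (real DIM('a) - \<alpha>))) *
            emeasure lebesgue {x. infdist x (frontier \<Omega>) < h}"
    proof eventually_elim
      case (elim h)
      have "h powr (- (real DIM('a) - \<alpha>)) * (c * h) = c * h powr (- \<beta>)"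
        using elim(2) by (simp add: \<beta>_def powr_diff powr_minus powr_add field_simps)
      then have "ennreal C \<le> ennreal (h powr (- (real DIM('a) - \<alpha>)) * (c * h))"
        using elim(1) by (simp only: ennreal_leI)
      also have "\<dots> = ennreal (h powr (- (real DIM('a) - \<alpha>))) * ennreal (c * h)"
        using elim c by (intro ennreal_mult) auto
      also have "\<dots> \<le> ennreal (h powr (- (real DIM('a) - \<alpha>))) * emeasure lebesgue {x. infdist x (frontier \<Omega>) < h}"
        using c elim by (intro mult_left_mono) auto
      finally show ?case .
    qed
  qed simp
  then show ?thesis
    by (cases "upper_minkowski_content (frontier \<Omega>) \<alpha>")
      (auto, metis ennreal_le_iff less_add_one linorder_not_le)
qed

text \<open>The infimum in the definition ranges over a nonempty set, since the exponent \<open>d\<close> belongs to it, and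
  every exponent in this set is at least \<open>d - 1\<close>.\<close>

lemma upper_minkowski_dim_frontier_ge:
  fixes \<Omega> :: "'a::euclidean_space set"
  assumes \<Omega>: "open \<Omega>" "bounded \<Omega>" "measure lebesgue \<Omega> > 0"
  shows "real DIM('a) - 1 \<le> upper_minkowski_dim (frontier \<Omega>)"
  unfolding upper_minkowski_dim_def
proof (rule cInf_greatest)
  have "\<Omega> \<noteq> {}" "\<Omega> \<noteq> UNIV" using \<Omega> by auto
  hence fr: "compact (frontier \<Omega>)" "frontier \<Omega> \<noteq> {}"
    using \<Omega>(2) by (auto simp: frontier_eq_empty)
  let ?T = "{x. infdist x (frontier \<Omega>) < 1}"
  obtain L where L: "\<And>x. x \<in> frontier \<Omega> \<Longrightarrow> norm x \<le> L"
    using compact_imp_bounded[OF fr(1)] unfolding bounded_iff by blast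
  have "norm x \<le> L + 1" if "x \<in> ?T" for x
  proof -
    obtain p where "p \<in> frontier \<Omega>" "infdist x (frontier \<Omega>) = dist x p"
      using infdist_attains_inf[of "frontier \<Omega>" x] fr by (auto simp: compact_imp_closed)
    then show ?thesis using that L[of p] norm_triangle_ineq2[of x p] by (simp add: dist_norm)
  qed
  hence "bounded ?T" unfolding bounded_iff by blast
  hence fin: "emeasure lebesgue ?T < \<infinity>"
    using emeasure_bounded_finite[of ?T]
    by (simp add: borel_open open_Collect_less continuous_intros)
  have "upper_minkowski_content (frontier \<Omega>) (real DIM('a)) \<le> emeasure lebesgue ?T"
    unfolding upper_minkowski_content_def
  proof (rule Limsup_bounded)
    have "eventually (\<lambda>h. 0 < h \<and> h \<le> 1) (at_right (0::real))"
      by (auto simp: eventually_at_right_field intro!: exI[of _ 1])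
    then show "\<forall>\<^sub>F h in at_right 0. ennreal (h powr - (real DIM('a) - real DIM('a))) *
        emeasure lebesgue {x. infdist x (frontier \<Omega>) < h} \<le> emeasure lebesgue ?T"
    proof eventually_elim
      case (elim h)
      have "emeasure lebesgue {x. infdist x (frontier \<Omega>) < h} \<le> emeasure lebesgue ?T"
        using elim by (intro emeasure_mono) (auto intro!: borel_open open_Collect_less continuous_intros)
      then show ?case using elim by simp
    qed
  qed
  then have "real DIM('a) \<in> {\<alpha>. 0 \<le> \<alpha> \<and> upper_minkowski_content (frontier \<Omega>) \<alpha> < \<infinity>}"
    using fin by (auto intro: order.strict_trans1)
  then show "{\<alpha>. 0 \<le> \<alpha> \<and> upper_minkowski_content (frontier \<Omega>) \<alpha> < \<infinity>} \<noteq> {}" by blast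
next
  fix \<alpha> assume "\<alpha> \<in> {\<alpha>. 0 \<le> \<alpha> \<and> upper_minkowski_content (frontier \<Omega>) \<alpha> < \<infinity>}"
  then show "real DIM('a) - 1 \<le> \<alpha>"
    using upper_minkowski_content_frontier_infinite[OF \<Omega>, of \<alpha>] by fastforce
qed

section \<open>The counting estimate and its consequences\<close>

lemma open_contains_cube:
  fixes \<Omega> :: "'a::euclidean_space set"
  assumes "open \<Omega>" "\<Omega> \<noteq> {}"
  obtains a s where "s > 0" "cbox (a - s *\<^sub>R One) (a + s *\<^sub>R One) \<subseteq> \<Omega>"
proof -
  obtain a e where e: "e > 0" "cball a e \<subseteq> \<Omega>"
    using assms by (meson ex_in_conv open_contains_cball)
  define s where "s = e / real DIM('a)"
  have "x \<in> cball a e" if "x \<in> cbox (a - s *\<^sub>R One) (a + s *\<^sub>R One)" for x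
  proof -
    have "norm (x - a) \<le> (\<Sum>b\<in>Basis. \<bar>(x - a) \<bullet> b\<bar>)" by (rule norm_le_l1)
    also have "\<dots> \<le> (\<Sum>b\<in>(Basis::'a set). s)"
      using that by (intro sum_mono) (auto simp: mem_box inner_simps abs_le_iff algebra_simps)
    also have "\<dots> = e" by (simp add: s_def)
    finally show ?thesis by (simp add: dist_norm norm_minus_commute)
  qed
  hence "cbox (a - s *\<^sub>R One) (a + s *\<^sub>R One) \<subseteq> \<Omega>" using e(2) by blast
  moreover have "s > 0" using e(1) by (simp add: s_def)
  ultimately show thesis by (rule that[rotated])
qed

text \<open>The constant \<open>C\<close> is chosen before \<open>\<Lambda>\<close>, \<open>A\<close> and \<open>R\<close>. This uniformity is what allows the constant in the
  bound by the Minkowski content to serve all orthogonal bases of the same domain.\<close>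

lemma frame_counting_estimate:
  fixes \<Omega> K :: "'a::euclidean_space set"
  assumes \<Omega>: "open \<Omega>" "measure lebesgue \<Omega> > 0"
    and K: "convex_body K" "\<forall>x\<in>K. - x \<in> K" and B: "B > 0"
  obtains C where "C > 0"
    "\<And>\<Lambda> A R. exp_frame \<Omega> \<Lambda> A B \<Longrightarrow> R > 0 \<Longrightarrow> finite (freqs K \<Lambda> R)"
    "\<And>\<Lambda> A R. exp_frame \<Omega> \<Lambda> A B \<Longrightarrow> R \<ge> 1 \<Longrightarrow>
       A * measure lebesgue \<Omega> * measure lebesgue K * R ^ DIM('a) - C * R ^ (DIM('a) - 1) \<le> real (card (freqs K \<Lambda> R))"
    "\<And>\<Lambda> A R. exp_frame \<Omega> \<Lambda> A B \<Longrightarrow> R \<ge> 1 \<Longrightarrow>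
       real (card (freqs K \<Lambda> R)) \<le> B * measure lebesgue \<Omega> * measure lebesgue K * R ^ DIM('a) + C * R ^ (DIM('a) - 1)"
proof -
  obtain e where e: "e > 0" "cball 0 e \<subseteq> K"
    using symmetric_convex_body_contains_cball[OF K] by blast
  have Kc: "compact K" "convex K" using K(1) by (auto simp: convex_body_def)
  have "\<Omega> \<noteq> {}" using \<Omega>(2) by auto
  then obtain a s where s: "s > 0" "cbox (a - s *\<^sub>R One) (a + s *\<^sub>R One) \<subseteq> \<Omega>"
    using open_contains_cube[OF \<Omega>(1)] by blast
  define m where "m = measure lebesgue \<Omega>"
  define \<psi> where "\<psi> = (window_spectrum s :: 'a \<Rightarrow> real)"
  define G where "G = (2 * s / 3) ^ DIM('a)"
  have G: "G > 0" using s(1) by (simp add: G_def)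
  have m: "m > 0" using \<Omega>(2) by (simp add: m_def)
  have nn: "0 \<le> \<psi> \<eta>" for \<eta> unfolding \<psi>_def by (rule window_spectrum_nonneg)
  have \<psi>0: "\<psi> 0 > 0" unfolding \<psi>_def using window_spectrum_0_pos[OF s(1)] .
  have int: "(\<integral>\<^sup>+\<eta>. ennreal (\<psi> \<eta>) \<partial>lborel) = ennreal G"
    unfolding \<psi>_def G_def by (rule nn_integral_window_spectrum[OF s(1)])
  obtain M where M: "(\<integral>\<^sup>+\<eta>. ennreal (\<psi> \<eta> * (1 + norm \<eta>)) \<partial>lborel) = ennreal M" "M \<ge> 0"
    using nn_integral_window_spectrum_moment_finite[OF s(1), where ?'a = 'a]
    unfolding \<psi>_def by (cases "\<integral>\<^sup>+\<eta>. ennreal (window_spectrum s \<eta> * (1 + norm \<eta>)) \<partial>(lborel :: 'a measure)") auto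
  have "open {\<eta>. \<psi> 0 / 2 < \<psi> \<eta>}"
    unfolding \<psi>_def by (intro open_Collect_less continuous_on_const continuous_on_window_spectrum)
  then obtain r where r: "r > 0" "ball 0 r \<subseteq> {\<eta>. \<psi> 0 / 2 < \<psi> \<eta>}"
    using \<psi>0 by (auto elim!: openE[of _ 0])
  \<comment> \<open>The number of frequencies in a ball of radius \<open>r\<close> is at most \<open>D\<close>; \<open>E\<close> is the constant of \<open>kernel_sum_counting\<close>.\<close>
  define D where "D = B * m * G / (\<psi> 0 / 2)"
  define E where "E = D * measure lebesgue K * real DIM('a) * (1 + r / e) ^ (DIM('a) - 1)
      * ((1 + 2 * r) / e) / measure lebesgue (ball (0::'a) r)"
  \<comment> \<open>The summand \<open>1\<close> makes the constant positive.\<close>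
  define C where "C = E * M / G + 1"
  have "E \<ge> 0" unfolding E_def D_def using B m G \<psi>0 r e
    by (intro divide_nonneg_nonneg mult_nonneg_nonneg) auto
  hence C: "C > 0" unfolding C_def using M(2) G by (intro add_nonneg_pos divide_nonneg_nonneg mult_nonneg_nonneg) auto
  have bounds: "ennreal (A * m * G) \<le> (\<Sum>\<^sub>\<infinity>l\<in>\<Lambda>. ennreal (\<psi> (l - \<xi>)))"
       "(\<Sum>\<^sub>\<infinity>l\<in>\<Lambda>. ennreal (\<psi> (l - \<xi>))) \<le> ennreal (B * m * G)"
    if frame: "exp_frame \<Omega> \<Lambda> A B" for \<Lambda> A \<xi>
  proof -
    note w = modulated_window_in_L2[OF s(1) \<Omega>(1) s(2), of \<xi>]
    let ?g = "\<lambda>x. complex_of_real (window a s x) * echar \<xi> x"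
    have "ennreal (A * m * (L2_norm \<Omega> ?g)\<^sup>2) \<le> (\<Sum>\<^sub>\<infinity>l\<in>\<Lambda>. ennreal ((cmod (fourier_on \<Omega> ?g l))\<^sup>2))"
      "(\<Sum>\<^sub>\<infinity>l\<in>\<Lambda>. ennreal ((cmod (fourier_on \<Omega> ?g l))\<^sup>2)) \<le> ennreal (B * m * (L2_norm \<Omega> ?g)\<^sup>2)"
      using frame w(1) unfolding exp_frame_def m_def by blast+
    then show "ennreal (A * m * G) \<le> (\<Sum>\<^sub>\<infinity>l\<in>\<Lambda>. ennreal (\<psi> (l - \<xi>)))"
       "(\<Sum>\<^sub>\<infinity>l\<in>\<Lambda>. ennreal (\<psi> (l - \<xi>))) \<le> ennreal (B * m * G)"
      unfolding w(2,3) \<psi>_def G_def by blast+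
  qed
  have BmG: "B * m * G \<ge> 0" using B m G by simp
  have density: "finite (\<Lambda> \<inter> ball x r)" "real (card (\<Lambda> \<inter> ball x r)) \<le> D"
    if frame: "exp_frame \<Omega> \<Lambda> A B" for \<Lambda> A x
  proof -
    have near0: "\<psi> 0 / 2 \<le> \<psi> \<eta>" if "\<eta> \<in> ball 0 r" for \<eta>
      using r(2) that by (intro less_imp_le) blast
    note local_count_of_kernel_sum[OF half_gt_zero[OF \<psi>0] near0 nn bounds(2)[OF frame] BmG]
    then show "finite (\<Lambda> \<inter> ball x r)" "real (card (\<Lambda> \<inter> ball x r)) \<le> D"
      unfolding D_def by blast+
  qed
  have fr: "freqs K \<Lambda> R = \<Lambda> \<inter> dilate R K" if "R > 0" for \<Lambda> R
    using body_norm_le_iff[OF Kc e that] by (auto simp: freqs_def)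
  have \<psi>m: "\<psi> \<in> borel_measurable borel" unfolding \<psi>_def by measurable
  show thesis
  proof (rule that[OF C])
    fix \<Lambda> :: "'a set" and A R :: real assume frame: "exp_frame \<Omega> \<Lambda> A B"
    {
      assume "R > 0"
      then show "finite (freqs K \<Lambda> R)"
        unfolding fr[OF \<open>R > 0\<close>]
        by (intro finite_Int_bounded[OF r(1) density(1)[OF frame]] compact_imp_bounded compact_scaling Kc)
    }
    assume R: "R \<ge> 1"
    hence fr': "freqs K \<Lambda> R = \<Lambda> \<inter> dilate R K" by (intro fr) auto
    have A: "A > 0" using frame by (simp add: exp_frame_def)
    note rules = Kc e \<psi>m nn int less_imp_le[OF G] M r(1) density[OF frame] R
    have R1: "R ^ (DIM('a) - 1) \<ge> 0" using R by simp
    have EMC: "E * M * R ^ (DIM('a) - 1) \<le> C * R ^ (DIM('a) - 1) * G"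
    proof -
      have "E * M \<le> C * G" using G by (simp add: C_def field_simps)
      then show ?thesis using R1 by (metis mult.commute mult.left_commute mult_left_mono)
    qed
    have "real (card (\<Lambda> \<inter> dilate R K)) * G \<le> B * m * G * measure lebesgue K * R ^ DIM('a) + E * M * R ^ (DIM('a) - 1)"
      unfolding E_def by (rule kernel_sum_counting_upper[OF rules bounds(2)[OF frame] BmG])
    also have "\<dots> \<le> (B * m * measure lebesgue K * R ^ DIM('a) + C * R ^ (DIM('a) - 1)) * G"
      using EMC by (simp add: algebra_simps)
    finally show "real (card (freqs K \<Lambda> R)) \<le> B * measure lebesgue \<Omega> * measure lebesgue K * R ^ DIM('a) + C * R ^ (DIM('a) - 1)"
      using G unfolding fr' m_def by (simp add: mult_le_cancel_right)
    have "A * m * G * measure lebesgue K * R ^ DIM('a) \<le> real (card (\<Lambda> \<inter> dilate R K)) * G + E * M * R ^ (DIM('a) - 1)"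
      unfolding E_def using A m G
      by (intro kernel_sum_counting_lower[OF rules bounds(1)[OF frame]]) simp
    also have "\<dots> \<le> (real (card (\<Lambda> \<inter> dilate R K)) + C * R ^ (DIM('a) - 1)) * G"
      using EMC by (simp add: algebra_simps)
    finally have "(A * m * measure lebesgue K * R ^ DIM('a)) * G \<le> (real (card (\<Lambda> \<inter> dilate R K)) + C * R ^ (DIM('a) - 1)) * G"
      by (simp add: mult_ac)
    hence "A * m * measure lebesgue K * R ^ DIM('a) \<le> real (card (\<Lambda> \<inter> dilate R K)) + C * R ^ (DIM('a) - 1)"
      using G by (rule mult_right_le_imp_le)
    then show "A * measure lebesgue \<Omega> * measure lebesgue K * R ^ DIM('a) - C * R ^ (DIM('a) - 1) \<le> real (card (freqs K \<Lambda> R))"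
      unfolding fr' m_def by simp
  qed
qed

lemma symmetric_convex_body_measure_pos:
  fixes K :: "'a::euclidean_space set"
  assumes K: "convex_body K" "\<forall>x\<in>K. - x \<in> K"
  shows "measure lebesgue K > 0"
proof -
  obtain e where e: "e > 0" "cball 0 e \<subseteq> K"
    using symmetric_convex_body_contains_cball[OF K] by blast
  have "0 < measure lebesgue (cball (0::'a) e)" using e(1) content_cball_pos[of e 0] by simp
  also have "\<dots> \<le> measure lebesgue K"
    using K e(2) by (intro measure_mono_fmeasurable) (auto simp: convex_body_def lmeasurable_compact)
  finally show ?thesis .
qed

theorem theorem1:
  fixes \<Omega> K :: "'a::euclidean_space set"
  assumes "open \<Omega>" "connected \<Omega>" "bounded \<Omega>" "measure lebesgue \<Omega> > 0"
    and "convex_body K" "\<forall>x\<in>K. - x \<in> K"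
  shows
    "(\<forall>\<Lambda>. exp_orthogonal_basis \<Omega> \<Lambda> \<longrightarrow>
        (\<forall>R>0. finite (freqs K \<Lambda> R)) \<and>
        (\<lambda>R. weyl_error \<Omega> K \<Lambda> R) \<in> o[at_top](\<lambda>R. R ^ DIM('a)))
     \<and>
     (\<forall>\<alpha>. upper_minkowski_dim (frontier \<Omega>) = \<alpha> \<and> \<alpha> < real DIM('a) \<and>
          upper_minkowski_content (frontier \<Omega>) \<alpha> > 0 \<longrightarrow>
        (\<exists>C::real. C > 0 \<and>
          (\<forall>\<Lambda>. exp_orthogonal_basis \<Omega> \<Lambda> \<longrightarrow>
            (\<forall>R\<ge>1. ennreal \<bar>weyl_error \<Omega> K \<Lambda> R\<bar>
                \<le> ennreal C * upper_minkowski_content (frontier \<Omega>) \<alpha> * ennreal (R powr \<alpha>)))))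
     \<and>
     (\<forall>\<Lambda> A B. exp_frame \<Omega> \<Lambda> A B \<longrightarrow>
        (\<forall>R>0. finite (freqs K \<Lambda> R)) \<and>
        ereal (A * measure lebesgue \<Omega>)
          \<le> Liminf at_top (\<lambda>R::real. ereal (real (card (freqs K \<Lambda> R)) / (measure lebesgue K * R ^ DIM('a)))) \<and>
        Limsup at_top (\<lambda>R::real. ereal (real (card (freqs K \<Lambda> R)) / (measure lebesgue K * R ^ DIM('a))))
          \<le> ereal (B * measure lebesgue \<Omega>))"
proof -
  note \<Omega> = assms(1,3,4) and K = assms(5,6)
  define d where "d = DIM('a)"
  define m k where "m = measure lebesgue \<Omega>" and "k = measure lebesgue K"
  have k: "k > 0" unfolding k_def by (rule symmetric_convex_body_measure_pos[OF K])
  have d: "d \<ge> 1" unfolding d_def using DIM_positive[where ?'a = 'a] by linarith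
  have Rd: "R ^ d = R * R ^ (d - 1)" for R :: real using d by (cases d) auto
  have \<Omega>m: "\<Omega> \<in> lmeasurable" using \<Omega> by (simp add: lmeasurable_open)
  obtain C where C: "C > 0"
    and fin: "\<And>\<Lambda> A R. exp_frame \<Omega> \<Lambda> A 1 \<Longrightarrow> R > 0 \<Longrightarrow> finite (freqs K \<Lambda> R)"
    and lo: "\<And>\<Lambda> A R. exp_frame \<Omega> \<Lambda> A 1 \<Longrightarrow> R \<ge> 1 \<Longrightarrow>
       A * m * k * R ^ d - C * R ^ (d - 1) \<le> real (card (freqs K \<Lambda> R))"
    and up: "\<And>\<Lambda> A R. exp_frame \<Omega> \<Lambda> A 1 \<Longrightarrow> R \<ge> 1 \<Longrightarrow>
       real (card (freqs K \<Lambda> R)) \<le> 1 * m * k * R ^ d + C * R ^ (d - 1)"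
    using frame_counting_estimate[OF \<Omega>(1,3) K zero_less_one] unfolding d_def m_def k_def by metis
  have frame: "exp_frame \<Omega> \<Lambda> 1 1" if "exp_orthogonal_basis \<Omega> \<Lambda>" for \<Lambda>
    by (rule exp_orthogonal_basis_imp_frame[OF \<Omega>m \<Omega>(3) that])
  have err: "\<bar>weyl_error \<Omega> K \<Lambda> R\<bar> \<le> C * R ^ (d - 1)" if "exp_orthogonal_basis \<Omega> \<Lambda>" "R \<ge> 1" for \<Lambda> R
    using lo[OF frame[OF that(1)] that(2)] up[OF frame[OF that(1)] that(2)]
    unfolding weyl_error_def m_def[symmetric] k_def[symmetric] d_def[symmetric]
    by (simp add: abs_le_iff mult_ac)
  have lim: "((\<lambda>R::real. c / R) \<longlongrightarrow> 0) at_top" for c :: real by real_asymp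
  show ?thesis
  proof (intro conjI allI impI)
    fix \<Lambda> and R :: real assume "exp_orthogonal_basis \<Omega> \<Lambda>" "R > 0"
    then show "finite (freqs K \<Lambda> R)" using fin frame by blast
  next
    fix \<Lambda> assume basis: "exp_orthogonal_basis \<Omega> \<Lambda>"
    have "(\<lambda>R. weyl_error \<Omega> K \<Lambda> R) \<in> O[at_top](\<lambda>R. R ^ (d - 1))"
    proof (rule bigoI[where c = C])
      show "\<forall>\<^sub>F R in at_top. norm (weyl_error \<Omega> K \<Lambda> R) \<le> C * norm (R ^ (d - 1))"
        using eventually_ge_at_top[of "1::real"]
        by eventually_elim (use err[OF basis] in \<open>simp add: abs_of_nonneg\<close>)
    qed
    also have "(\<lambda>R::real. R ^ (d - 1)) \<in> o[at_top](\<lambda>R. R ^ d)"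
    proof (rule smalloI_tendsto)
      show "((\<lambda>R::real. R ^ (d - 1) / R ^ d) \<longlongrightarrow> 0) at_top"
        using lim[of 1]
      proof (rule Lim_transform_eventually)
        show "\<forall>\<^sub>F R::real in at_top. 1 / R = R ^ (d - 1) / R ^ d"
          using eventually_gt_at_top[of "0::real"] by eventually_elim (simp add: Rd)
      qed
      show "\<forall>\<^sub>F R in at_top. (R::real) ^ d \<noteq> 0"
        using eventually_gt_at_top[of "0::real"] by eventually_elim simp
    qed
    finally show "(\<lambda>R. weyl_error \<Omega> K \<Lambda> R) \<in> o[at_top](\<lambda>R. R ^ DIM('a))"
      unfolding d_def .
  next
    fix \<alpha>
    assume \<alpha>: "upper_minkowski_dim (frontier \<Omega>) = \<alpha> \<and> \<alpha> < real DIM('a) \<and>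
          upper_minkowski_content (frontier \<Omega>) \<alpha> > 0"
    have "real d - 1 \<le> \<alpha>"
      using upper_minkowski_dim_frontier_ge[OF \<Omega>] \<alpha> by (simp add: d_def)
    hence pw: "R ^ (d - 1) \<le> R powr \<alpha>" if "R \<ge> 1" for R :: real
      using powr_mono[of "real (d - 1)" \<alpha> R] that d by (simp add: powr_realpow[symmetric] of_nat_diff)
    show "\<exists>C::real. C > 0 \<and>
          (\<forall>\<Lambda>. exp_orthogonal_basis \<Omega> \<Lambda> \<longrightarrow>
            (\<forall>R\<ge>1. ennreal \<bar>weyl_error \<Omega> K \<Lambda> R\<bar>
                \<le> ennreal C * upper_minkowski_content (frontier \<Omega>) \<alpha> * ennreal (R powr \<alpha>)))"
    proof (cases "upper_minkowski_content (frontier \<Omega>) \<alpha>")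
      \<comment> \<open>For infinite content the right-hand side is infinite.\<close>
      case top
      show ?thesis
      proof (intro exI[of _ 1] conjI allI impI)
        fix R :: real assume "R \<ge> 1"
        hence "ennreal 1 * upper_minkowski_content (frontier \<Omega>) \<alpha> * ennreal (R powr \<alpha>) = top"
          unfolding top by (simp add: ennreal_top_mult)
        then show "ennreal \<bar>weyl_error \<Omega> K \<Lambda> R\<bar> \<le> ennreal 1 * upper_minkowski_content (frontier \<Omega>) \<alpha> * ennreal (R powr \<alpha>)" for \<Lambda>
          by (simp only: top_greatest)
      qed simp
    next
      case (real \<kappa>)
      hence \<kappa>: "\<kappa> > 0" using \<alpha> by simp
      show ?thesis
      proof (intro exI[of _ "C / \<kappa>"] conjI allI impI)
        show "C / \<kappa> > 0" using C \<kappa> by simp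
        fix \<Lambda> and R :: real assume "exp_orthogonal_basis \<Omega> \<Lambda>" "R \<ge> 1"
        hence "\<bar>weyl_error \<Omega> K \<Lambda> R\<bar> \<le> C * R ^ (d - 1)" by (rule err)
        also have "\<dots> \<le> C * R powr \<alpha>" using pw[OF \<open>R \<ge> 1\<close>] C by simp
        also have "\<dots> = C / \<kappa> * \<kappa> * R powr \<alpha>" using \<kappa> by simp
        finally have "ennreal \<bar>weyl_error \<Omega> K \<Lambda> R\<bar> \<le> ennreal (C / \<kappa> * \<kappa> * R powr \<alpha>)" by (rule ennreal_leI)
        also have "\<dots> = ennreal (C / \<kappa>) * ennreal \<kappa> * ennreal (R powr \<alpha>)"
          using C \<kappa> by (subst ennreal_mult, simp, simp, subst ennreal_mult) auto
        finally show "ennreal \<bar>weyl_error \<Omega> K \<Lambda> R\<bar>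
           \<le> ennreal (C / \<kappa>) * upper_minkowski_content (frontier \<Omega>) \<alpha> * ennreal (R powr \<alpha>)"
          unfolding real .
      qed
    qed
  next
    fix \<Lambda> A B and R :: real assume fr: "exp_frame \<Omega> \<Lambda> A B" "R > 0"
    have "B > 0" using fr(1) by (simp add: exp_frame_def)
    from frame_counting_estimate[OF \<Omega>(1,3) K this] fr show "finite (freqs K \<Lambda> R)" by metis
  next
    fix \<Lambda> A B assume fr: "exp_frame \<Omega> \<Lambda> A B"
    have "B > 0" using fr by (simp add: exp_frame_def)
    obtain C where lo: "\<And>R. R \<ge> 1 \<Longrightarrow> A * m * k * R ^ d - C * R ^ (d - 1) \<le> real (card (freqs K \<Lambda> R))"
      and up: "\<And>R. R \<ge> 1 \<Longrightarrow> real (card (freqs K \<Lambda> R)) \<le> B * m * k * R ^ d + C * R ^ (d - 1)"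
      using frame_counting_estimate[OF \<Omega>(1,3) K \<open>B > 0\<close>] fr unfolding d_def m_def k_def by metis
    define N where "N = (\<lambda>R. real (card (freqs K \<Lambda> R)) / (k * R ^ d))"
    have "A * m - (C / k) / R \<le> N R" "N R \<le> B * m + (C / k) / R" if R: "R \<ge> 1" for R
    proof -
      have p: "k * R ^ d > 0" using k R by simp
      have "(A * m - (C / k) / R) * (k * R ^ d) = A * m * k * R ^ d - C * R ^ (d - 1)"
        using k R by (simp add: Rd field_simps)
      then show "A * m - (C / k) / R \<le> N R"
        unfolding N_def using lo[OF R] p by (simp only: pos_le_divide_eq)
      have "(B * m + (C / k) / R) * (k * R ^ d) = B * m * k * R ^ d + C * R ^ (d - 1)"
        using k R by (simp add: Rd field_simps)
      then show "N R \<le> B * m + (C / k) / R"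
        unfolding N_def using up[OF R] p by (simp only: pos_divide_le_eq)
    qed
    note bounds = this
    have ev: "\<forall>\<^sub>F R in at_top. ereal (A * m - (C / k) / R) \<le> ereal (N R)"
      using eventually_ge_at_top[of "1::real"] by eventually_elim (simp only: ereal_less_eq bounds)
    have ev': "\<forall>\<^sub>F R in at_top. ereal (N R) \<le> ereal (B * m + (C / k) / R)"
      using eventually_ge_at_top[of "1::real"] by eventually_elim (simp only: ereal_less_eq bounds)
    have "((\<lambda>R. ereal (A * m - (C / k) / R)) \<longlongrightarrow> ereal (A * m - 0)) at_top"
      by (intro tendsto_intros lim)
    hence "Liminf at_top (\<lambda>R. ereal (A * m - (C / k) / R)) = ereal (A * m - 0)"
      by (rule lim_imp_Liminf[OF trivial_limit_at_top_linorder])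
    hence "ereal (A * m) = Liminf at_top (\<lambda>R. ereal (A * m - (C / k) / R))"
      by (simp only: diff_0_right)
    also have "\<dots> \<le> Liminf at_top (\<lambda>R. ereal (N R))" by (rule Liminf_mono[OF ev])
    finally show "ereal (A * measure lebesgue \<Omega>)
          \<le> Liminf at_top (\<lambda>R::real. ereal (real (card (freqs K \<Lambda> R)) / (measure lebesgue K * R ^ DIM('a))))"
      unfolding N_def m_def k_def d_def .
    have "((\<lambda>R. ereal (B * m + (C / k) / R)) \<longlongrightarrow> ereal (B * m + 0)) at_top"
      by (intro tendsto_intros lim)
    hence lim_up: "Limsup at_top (\<lambda>R. ereal (B * m + (C / k) / R)) = ereal (B * m + 0)"
      by (rule lim_imp_Limsup[OF trivial_limit_at_top_linorder])
    have "Limsup at_top (\<lambda>R. ereal (N R)) \<le> Limsup at_top (\<lambda>R. ereal (B * m + (C / k) / R))"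
      by (rule Limsup_mono[OF ev'])
    also have "\<dots> = ereal (B * m)"
      using lim_up by (simp only: add_0_right)
    finally show "Limsup at_top (\<lambda>R::real. ereal (real (card (freqs K \<Lambda> R)) / (measure lebesgue K * R ^ DIM('a))))
          \<le> ereal (B * measure lebesgue \<Omega>)"
      unfolding N_def m_def k_def d_def .
  qed
qed

end
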